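(* If $(H_{10},\Lambda)$ is a signified graph on $10$ vertices such that every signified graph whose underlying graph is planar admits a signed homomorphism to $(H_{10},\Lambda)$, then $(H_{10},\Lambda)$ is, up to resigning a subset of its vertices, isomorphic (by a sign-preserving isomorphism) to $SP_9^+$.
   Context: A signified graph $(G,\Sigma)$ is a graph $G$ with a set $\Sigma\subseteq E(G)$ of negative edges, other edges positive. Resigning $X\subseteq V(G)$ changes the sign of exactly the edges with one endpoint in $X$; two signified graphs on $G$ are equivalent if one is obtained from the other by resigning. A signified homomorphism is a vertex map sending each edge to an edge of the same sign; a signed homomorphism of $(G,\Sigma)$ to $(H,\Lambda)$ is a signified homomorphism between some signified graphs equivalent to $(G,\Sigma)$ and $(H,\Lambda)$. $SP_9$ is the complete graph on $\mathbb{F}_9$ where $xy$ is negative iff $y-x$ is a non-square in $\mathbb{F}_9$, and $SP_9^+$ is $SP_9$ plus a new vertex joined by positive edges to all nine vertices. *)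

theory Defs
  imports "HOL-Analysis.Analysis"
begin

text \<open>A graph is a pair of a vertex set V and an edge set E, each edge being a
two-element subset of V. A signified graph additionally carries a set S of
negative edges, S a subset of E.\<close>

definition simple_graph :: "'a set \<Rightarrow> 'a set set \<Rightarrow> bool" where
  "simple_graph V E \<longleftrightarrow> finite V \<and> (\<forall>e\<in>E. e \<subseteq> V \<and> card e = 2)"

definition signified_graph :: "'a set \<Rightarrow> 'a set set \<Rightarrow> 'a set set \<Rightarrow> bool" where
  "signified_graph V E S \<longleftrightarrow> simple_graph V E \<and> S \<subseteq> E"

definition resign :: "'a set set \<Rightarrow> 'a set \<Rightarrow> 'a set set \<Rightarrow> 'a set set" where
  "resign E X S = {e \<in> E. (e \<in> S) \<noteq> (card (e \<inter> X) = 1)}"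

definition signified_hom ::
  "'a set \<Rightarrow> 'a set set \<Rightarrow> 'a set set \<Rightarrow> 'b set \<Rightarrow> 'b set set \<Rightarrow> 'b set set \<Rightarrow> ('a \<Rightarrow> 'b) \<Rightarrow> bool" where
  "signified_hom V1 E1 S1 V2 E2 S2 f \<longleftrightarrow>
     f ` V1 \<subseteq> V2 \<and> (\<forall>e\<in>E1. f ` e \<in> E2 \<and> (f ` e \<in> S2 \<longleftrightarrow> e \<in> S1))"

definition signed_hom_exists ::
  "'a set \<Rightarrow> 'a set set \<Rightarrow> 'a set set \<Rightarrow> 'b set \<Rightarrow> 'b set set \<Rightarrow> 'b set set \<Rightarrow> bool" where
  "signed_hom_exists V1 E1 S1 V2 E2 S2 \<longleftrightarrow>
     (\<exists>X Y f. X \<subseteq> V1 \<and> Y \<subseteq> V2 \<and>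
        signified_hom V1 E1 (resign E1 X S1) V2 E2 (resign E2 Y S2) f)"

definition planar :: "'a set \<Rightarrow> 'a set set \<Rightarrow> bool" where
  "planar V E \<longleftrightarrow>
     (\<exists>(p :: 'a \<Rightarrow> real^2) (\<gamma> :: 'a set \<Rightarrow> real \<Rightarrow> real^2).
        inj_on p V \<and>
        (\<forall>e\<in>E. arc (\<gamma> e) \<and> {pathstart (\<gamma> e), pathfinish (\<gamma> e)} = p ` e \<and>
                 path_image (\<gamma> e) \<inter> p ` V = p ` e) \<and>
        (\<forall>e\<in>E. \<forall>e'\<in>E. e \<noteq> e' \<longrightarrow> path_image (\<gamma> e) \<inter> path_image (\<gamma> e') \<subseteq> p ` (e \<inter> e')))"

text \<open>F_9 is realised as F_3[i] with i^2 = -1 (x^2+1 is irreducible over F_3):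
elements are pairs (a,b) with a,b in {0,1,2}, standing for a + b i.\<close>

definition F9 :: "(int \<times> int) set" where
  "F9 = {0..2} \<times> {0..2}"

definition F9_sub :: "int \<times> int \<Rightarrow> int \<times> int \<Rightarrow> int \<times> int" where
  "F9_sub x y = ((fst x - fst y) mod 3, (snd x - snd y) mod 3)"

definition F9_mult :: "int \<times> int \<Rightarrow> int \<times> int \<Rightarrow> int \<times> int" where
  "F9_mult x y = ((fst x * fst y - snd x * snd y) mod 3, (fst x * snd y + snd x * fst y) mod 3)"

definition F9_square :: "int \<times> int \<Rightarrow> bool" where
  "F9_square x \<longleftrightarrow> (\<exists>z\<in>F9. F9_mult z z = x)"

definition SP9_V :: "(int \<times> int) set" where
  "SP9_V = F9"

definition SP9_E :: "(int \<times> int) set set" where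
  "SP9_E = {{x, y} | x y. x \<in> F9 \<and> y \<in> F9 \<and> x \<noteq> y}"

text \<open>xy negative iff y - x is a non-square (well defined since -1 is a square in F_9).\<close>
definition SP9_S :: "(int \<times> int) set set" where
  "SP9_S = {{x, y} | x y. x \<in> F9 \<and> y \<in> F9 \<and> x \<noteq> y \<and> \<not> F9_square (F9_sub y x)}"

definition SP9p_V :: "(int \<times> int) option set" where
  "SP9p_V = insert None (Some ` F9)"

definition SP9p_E :: "(int \<times> int) option set set" where
  "SP9p_E = ((\<lambda>e. Some ` e) ` SP9_E) \<union> {{None, Some x} | x. x \<in> F9}"

definition SP9p_S :: "(int \<times> int) option set set" where
  "SP9p_S = (\<lambda>e. Some ` e) ` SP9_S"

definition iso_up_to_resigning ::
  "'a set \<Rightarrow> 'a set set \<Rightarrow> 'a set set \<Rightarrow> 'b set \<Rightarrow> 'b set set \<Rightarrow> 'b set set \<Rightarrow> bool" where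
  "iso_up_to_resigning V1 E1 S1 V2 E2 S2 \<longleftrightarrow>
     (\<exists>X \<phi>. X \<subseteq> V1 \<and> bij_betw \<phi> V1 V2 \<and>
        (\<forall>e. e \<subseteq> V1 \<longrightarrow> (e \<in> E1 \<longleftrightarrow> \<phi> ` e \<in> E2)) \<and>
        (\<forall>e\<in>E1. e \<in> resign E1 X S1 \<longleftrightarrow> \<phi> ` e \<in> S2))"

end

theory Submission
  imports Defs
begin

text \<open>One planar graph suffices: a cone (apex joined to every vertex) over an outerplanar graph
built from nested fans whose paths alternate in sign. If the apex maps to \<open>h\<close>, then the signs
of the triangles through \<open>h\<close>, which are invariant under resigning, 2-colour the pairs of neighbours
of \<open>h\<close>, and the outerplanar graph maps into this coloured graph on at most 9 vertices. Iterating
the fans yields a nonempty set \<open>U\<close> of vertices each of whose colour neighbourhoods in \<open>U\<close>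
carries a long alternating walk. Such a walk contains a set in which every vertex meets both
colours, and such a set has at least 4 elements. As 4 + 4 + 1 = 9, the graph has exactly 9 vertices,
is complete, and has 4 edges of each colour at every vertex. Counting the edges between the two
neighbourhoods of a vertex shows that positive edges lie in one positive triangle and negative
pairs have two common positive neighbours, which forces the 3 by 3 rook's graph, i.e. \<open>SP\<^sub>9\<close>.\<close>

section \<open>Planarity of cones over noncrossing chords\<close>

text \<open>Vertex 0 is the apex, placed below every tangent of the parabola used; the other vertices lie on
the parabola, so that chords stay above it and spokes below it.\<close>

definition parabola_pt :: "real \<Rightarrow> nat \<Rightarrow> real^2" where
  "parabola_pt M i = (if i = 0 then vector [0, - M] else vector [real i, (real i)\<^sup>2])"

lemma parabola_pt_0: "parabola_pt M 0 $ 1 = 0" "parabola_pt M 0 $ 2 = - M"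
  by (simp_all add: parabola_pt_def)

lemma parabola_pt_pos:
  "0 < i \<Longrightarrow> parabola_pt M i $ 1 = real i" "0 < i \<Longrightarrow> parabola_pt M i $ 2 = (real i)\<^sup>2"
  by (simp_all add: parabola_pt_def)

lemma vec2_eqI: "x $ 1 = y $ 1 \<Longrightarrow> x $ 2 = y $ 2 \<Longrightarrow> x = (y :: real^2)"
  by (simp add: vec_eq_iff forall_2)

lemma inj_parabola_pt:
  assumes "0 < M" shows "inj (parabola_pt M)"
proof (rule injI)
  fix i j assume eq: "parabola_pt M i = parabola_pt M j"
  have pos: "i = 0" if "j = 0" "parabola_pt M i = parabola_pt M j" for i j
  proof (rule ccontr)
    assume "i \<noteq> 0"
    then have "parabola_pt M i $ 2 = (real i)\<^sup>2" by (simp add: parabola_pt_pos)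
    moreover have "parabola_pt M i $ 2 = - M" unfolding that(2) that(1) by (rule parabola_pt_0)
    moreover have "0 \<le> (real i)\<^sup>2" by simp
    ultimately show False using assms by linarith
  qed
  show "i = j"
  proof (cases "i = 0 \<or> j = 0")
    case True
    then show ?thesis using pos[OF _ eq] pos[OF _ eq[symmetric]] by auto
  next
    case False
    moreover have "parabola_pt M i $ 1 = parabola_pt M j $ 1" using eq by (rule arg_cong)
    ultimately have "real i = real j" by (simp add: parabola_pt_pos)
    then show ?thesis by simp
  qed
qed

text \<open>Chord height minus parabola height is a quadratic in the abscissa with leading
  coefficient -1 and zeros \<open>i\<close> and \<open>j\<close>. Comparing two chords thus reduces
  to comparing these excesses.\<close>

lemma parabola_chord:
  assumes "0 < i" "i < j" "z \<in> closed_segment (parabola_pt M i) (parabola_pt M j)"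
  shows "real i \<le> z $ 1" "z $ 1 \<le> real j"
    "z $ 2 = (z $ 1)\<^sup>2 + (z $ 1 - real i) * (real j - z $ 1)"
proof -
  obtain u where u: "0 \<le> u" "u \<le> 1"
    and z: "z = (1 - u) *\<^sub>R parabola_pt M i + u *\<^sub>R parabola_pt M j"
    using assms(3) by (auto simp: in_segment)
  have z1: "z $ 1 = (1 - u) * real i + u * real j"
    and z2: "z $ 2 = (1 - u) * (real i)\<^sup>2 + u * (real j)\<^sup>2"
    using assms by (simp_all add: z parabola_pt_pos)
  have e: "z $ 1 - real i = u * (real j - real i)" "real j - z $ 1 = (1 - u) * (real j - real i)"
    by (simp_all add: z1 algebra_simps)
  show "real i \<le> z $ 1" using e(1) u assms(2)
    by (metis diff_ge_0_iff_ge less_imp_le mult_nonneg_nonneg of_nat_less_iff)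
  show "z $ 1 \<le> real j" using e(2) u assms(2)
    by (metis diff_ge_0_iff_ge less_imp_le mult_nonneg_nonneg of_nat_less_iff)
  show "z $ 2 = (z $ 1)\<^sup>2 + (z $ 1 - real i) * (real j - z $ 1)"
    unfolding z1 z2 by (simp add: algebra_simps power2_eq_square)
qed

text \<open>The height above the parabola at parameter \<open>u\<close> is (1 - u)(u i^2 - M), which
  is negative for u < 1 since i^2 < M. Spokes therefore stay strictly below the parabola until they
  reach their end.\<close>

lemma apex_segment:
  assumes "0 < i" "(real i)\<^sup>2 < M" "z \<in> closed_segment (parabola_pt M 0) (parabola_pt M i)"
  obtains u where "0 \<le> u" "u \<le> 1" "z $ 1 = u * real i" "z $ 2 = u * (real i)\<^sup>2 - (1 - u) * M"
    "z = parabola_pt M i \<or> z $ 2 < (z $ 1)\<^sup>2"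
proof -
  obtain u where u: "0 \<le> u" "u \<le> 1"
    and z: "z = (1 - u) *\<^sub>R parabola_pt M 0 + u *\<^sub>R parabola_pt M i"
    using assms(3) by (auto simp: in_segment)
  have z1: "z $ 1 = u * real i" and z2: "z $ 2 = u * (real i)\<^sup>2 - (1 - u) * M"
    using assms by (simp_all add: z parabola_pt_pos parabola_pt_0 algebra_simps)
  have "z = parabola_pt M i \<or> z $ 2 < (z $ 1)\<^sup>2"
  proof (cases "u = 1")
    case True then show ?thesis by (simp add: z)
  next
    case False
    have "z $ 2 - (z $ 1)\<^sup>2 = (1 - u) * (u * (real i)\<^sup>2 - M)"
      unfolding z1 z2 by (simp add: algebra_simps power2_eq_square)
    moreover have "u * (real i)\<^sup>2 \<le> (real i)\<^sup>2" using u by (simp add: mult_left_le_one_le)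
    then have "(1 - u) * (u * (real i)\<^sup>2 - M) < 0"
      using False u assms(2) by (intro mult_pos_neg) auto
    ultimately show ?thesis by simp
  qed
  then show thesis using that u z1 z2 by blast
qed

text \<open>Noncrossing of the chords \<open>a b\<close> and \<open>c d\<close>, read as intervals.
  The inequalities are weak so that chords may share an endpoint.\<close>

definition nested_or_apart :: "nat \<Rightarrow> nat \<Rightarrow> nat \<Rightarrow> nat \<Rightarrow> bool" where
  "nested_or_apart a b c d \<longleftrightarrow> b \<le> c \<or> d \<le> a \<or> (a \<le> c \<and> d \<le> b) \<or> (c \<le> a \<and> b \<le> d)"

text \<open>At a common point the excesses agree, while (x - c)(d - x) <= (x - a)(d - x) <= (x -
  a)(b - x). Equality in both steps pins the point to a shared endpoint.\<close>

lemma chords_meet_nested: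
  assumes "0 < a" "a < b" "0 < c" "c < d" "a \<le> c" "d \<le> b" "(a, b) \<noteq> (c, d)"
    and z: "z \<in> closed_segment (parabola_pt M a) (parabola_pt M b)"
      "z \<in> closed_segment (parabola_pt M c) (parabola_pt M d)"
  shows "z \<in> parabola_pt M ` ({a, b} \<inter> {c, d})"
proof -
  define x where "x = z $ 1"
  note 1 = parabola_chord[OF assms(1,2) z(1), folded x_def]
  note 2 = parabola_chord[OF assms(3,4) z(2), folded x_def]
  have eq: "(x - a) * (b - x) = (x - c) * (d - x)" using 1 2 by simp
  have le: "(x - c) * (d - x) \<le> (x - a) * (d - x)" "(x - a) * (d - x) \<le> (x - a) * (b - x)"
    by (rule mult_right_mono; use assms 1 2 in simp) (rule mult_left_mono; use assms 1 2 in simp)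
  have "(x - c) * (d - x) = (x - a) * (d - x)"
    using eq le by linarith
  then have "c = a \<or> x = d" by auto
  moreover have "(x - a) * (d - x) = (x - a) * (b - x)"
    using eq le by linarith
  then have "x = a \<or> d = b" by auto
  \<comment> \<open>Of the four combinations, \<open>c = a\<close> with \<open>d = b\<close> would
    make the chords equal, and \<open>x = d\<close> with \<open>x = a\<close> contradicts
    \<open>a <= c < d\<close>.\<close>
  ultimately have "x = a \<and> c = a \<or> x = d \<and> d = b"
    using assms(4,5,7) by (elim disjE) simp_all
  then show ?thesis
  proof
    assume h: "x = a \<and> c = a"
    then have "z = parabola_pt M a"
      using 1 assms(1) by (intro vec2_eqI) (simp_all add: parabola_pt_pos x_def[symmetric])
    then show ?thesis using h by auto
  next
    assume h: "x = d \<and> d = b"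
    then have "z = parabola_pt M b"
      using 1 assms(1,2) by (intro vec2_eqI) (simp_all add: parabola_pt_pos x_def[symmetric])
    then show ?thesis using h by auto
  qed
qed

lemma chords_meet_apart:
  assumes "0 < a" "a < b" "0 < c" "c < d" "b \<le> c"
    and z: "z \<in> closed_segment (parabola_pt M a) (parabola_pt M b)"
      "z \<in> closed_segment (parabola_pt M c) (parabola_pt M d)"
  shows "z \<in> parabola_pt M ` ({a, b} \<inter> {c, d})"
proof -
  note 1 = parabola_chord[OF assms(1,2) z(1)]
  note 2 = parabola_chord[OF assms(3,4) z(2)]
  have h: "b = c" "z $ 1 = b" using 1 2 assms by linarith+
  then have "z = parabola_pt M b"
    using 1 assms(1,2) by (intro vec2_eqI) (simp_all add: parabola_pt_pos)
  then show ?thesis using h by auto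
qed

lemma chords_meet:
  assumes "0 < a" "a < b" "0 < c" "c < d" "nested_or_apart a b c d" "(a, b) \<noteq> (c, d)"
    and z: "z \<in> closed_segment (parabola_pt M a) (parabola_pt M b)"
      "z \<in> closed_segment (parabola_pt M c) (parabola_pt M d)"
  shows "z \<in> parabola_pt M ` ({a, b} \<inter> {c, d})"
  using assms(5) unfolding nested_or_apart_def
proof (elim disjE)
  assume "b \<le> c" then show ?thesis using chords_meet_apart assms by blast
next
  assume "d \<le> a" then show ?thesis using chords_meet_apart[of c d a b z M] assms
    by (simp add: Int_commute)
next
  assume "a \<le> c \<and> d \<le> b" then show ?thesis using chords_meet_nested assms by blast
next
  assume "c \<le> a \<and> b \<le> d"
  moreover have "(c, d) \<noteq> (a, b)" using assms(6) by auto
  ultimately show ?thesis using chords_meet_nested[of c d a b z M] assms(1-4) z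
    by (metis Int_commute)
qed

text \<open>A spoke is on or below the parabola and a chord on or above it, so they meet on the
  parabola itself. There the spoke is at its end \<open>i\<close>, and zero excess makes
  \<open>i\<close> an end of the chord.\<close>

lemma apex_meets_chord:
  assumes "0 < i" "(real i)\<^sup>2 < M" "z \<in> closed_segment (parabola_pt M 0) (parabola_pt M i)"
    and "0 < c" "c < d" "z \<in> closed_segment (parabola_pt M c) (parabola_pt M d)"
  shows "z \<in> parabola_pt M ` ({0, i} \<inter> {c, d})"
proof -
  note 2 = parabola_chord[OF assms(4-6)]
  have ge: "z $ 2 \<ge> (z $ 1)\<^sup>2" using 2 by simp
  then have zi: "z = parabola_pt M i" using apex_segment[OF assms(1-3)] by fastforce
  then have "(real i - real c) * (real d - real i) = 0" using 2(3) assms(1)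
    by (simp add: parabola_pt_pos)
  then have "i \<in> {c, d}" by auto
  then show ?thesis using zi by blast
qed

text \<open>The spokes to \<open>i\<close> and \<open>j\<close> have slopes i + M/i and j + M/j,
  which for distinct \<open>i\<close>, \<open>j\<close> agree only if i j = M. Here i j < M, so they
  meet at the apex alone. The proof eliminates \<open>v\<close> to avoid dividing.\<close>

lemma apex_meets_apex:
  assumes "0 < i" "(real i)\<^sup>2 < M" "z \<in> closed_segment (parabola_pt M 0) (parabola_pt M i)"
    and "0 < j" "(real j)\<^sup>2 < M" "z \<in> closed_segment (parabola_pt M 0) (parabola_pt M j)" "i \<noteq> j"
  shows "z \<in> parabola_pt M ` ({0, i} \<inter> {0, j})"
proof -
  obtain u where u: "0 \<le> u" "u \<le> 1" "z $ 1 = u * real i" "z $ 2 = u * (real i)\<^sup>2 - (1 - u) * M"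
    using apex_segment[OF assms(1-3)] by metis
  obtain v where v: "0 \<le> v" "v \<le> 1" "z $ 1 = v * real j" "z $ 2 = v * (real j)\<^sup>2 - (1 - v) * M"
    using apex_segment[OF assms(4-6)] by metis
  have M: "0 < M" using assms(2) by (smt (verit) zero_le_power2)
  have e: "u * i = v * j" using u v by simp
  have "u * i * i + u * M = v * j * j + v * M"
    using u(4) v(4) by (simp add: algebra_simps power2_eq_square)
  moreover have "u * i * j = v * j * j" by (simp only: e)
  moreover have "u * (i * (i - real j) + M) = u * i * i + u * M - u * i * j"
    by (simp add: algebra_simps)
  ultimately have "u * (i * (i - real j) + M) = v * M" by linarith
  then have "u * (i * (i - real j) + M) * j = (v * j) * M" by (simp add: mult.commute mult.left_commute)
  then have "u * (i * (i - real j) + M) * j = u * i * M" by (simp only: e)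
  then have "u * ((i * (i - real j) + M) * j - i * M) = 0"
    unfolding right_diff_distrib mult.assoc by simp
  moreover have "(i * (i - real j) + M) * j - i * M = (i - real j) * (real i * j - M)"
    by (simp add: algebra_simps)
  moreover have "real i * j < M"
  proof -
    have "2 * (real i * j) \<le> (real i)\<^sup>2 + (real j)\<^sup>2" using sum_squares_bound[of "real i" "real j"] by simp
    then show ?thesis using assms by linarith
  qed
  ultimately have u0: "u = 0" using assms(7) by auto
  then have "z = parabola_pt M 0" using u by (intro vec2_eqI) (simp_all add: parabola_pt_0)
  then show ?thesis by simp
qed

lemma planar_apex_noncrossing:
  fixes V :: "nat set" and C :: "(nat \<times> nat) set" and A :: "nat set"
  assumes fin: "finite V" and A: "A \<subseteq> V - {0}"
    and C: "\<And>i j. (i, j) \<in> C \<Longrightarrow> 0 < i \<and> i < j \<and> i \<in> V \<and> j \<in> V"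
    and nc: "\<And>a b c d. (a, b) \<in> C \<Longrightarrow> (c, d) \<in> C \<Longrightarrow> nested_or_apart a b c d"
    and V0: "0 \<in> V"
  shows "planar V ((\<lambda>i. {0, i}) ` A \<union> (\<lambda>(i, j). {i, j}) ` C)" (is "planar V ?E")
proof -
  \<comment> \<open>One bound exceeding every squared label, as required by all spoke
    lemmas.\<close>
  define M where "M = (real (Max V))\<^sup>2 + 1"
  have M: "(real i)\<^sup>2 < M" if "i \<in> V" for i
  proof -
    have "real i \<le> real (Max V)" using fin that by simp
    then have "(real i)\<^sup>2 \<le> (real (Max V))\<^sup>2" by (intro power_mono) auto
    then show ?thesis unfolding M_def by linarith
  qed
  have MA: "(real i)\<^sup>2 < M" if "i \<in> A" for i using M A that by blast
  have M0: "0 < M" using M[OF V0] by simp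
  let ?p = "parabola_pt M"
  \<comment> \<open>Ordering the ends by \<open>Min\<close> and \<open>Max\<close> assigns one
    definite segment to the set \<open>e\<close>: spokes start at the apex, chords at their left
    end.\<close>
  let ?g = "\<lambda>e. linepath (?p (Min e)) (?p (Max e))"
  have inj: "?p i = ?p j \<longleftrightarrow> i = j" for i j using inj_parabola_pt[OF M0] by (simp add: inj_eq)
  have edge: "(\<exists>i. e = {0, i} \<and> i \<in> A \<and> 0 < i \<and> Min e = 0 \<and> Max e = i) \<or>
      (\<exists>i j. e = {i, j} \<and> (i, j) \<in> C \<and> 0 < i \<and> i < j \<and> i \<in> V \<and> j \<in> V \<and> Min e = i \<and> Max e = j)"
    if "e \<in> ?E" for e
    using that
  proof
    assume "e \<in> (\<lambda>i. {0, i}) ` A"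
    then obtain i where "e = {0, i}" "i \<in> A" by auto
    then show ?thesis using A by auto
  next
    assume "e \<in> (\<lambda>(i, j). {i, j}) ` C"
    then obtain i j where ij: "e = {i, j}" "(i, j) \<in> C" by auto
    then have "0 < i \<and> i < j \<and> i \<in> V \<and> j \<in> V" using C by blast
    then show ?thesis using ij by (intro disjI2 exI[of _ i] exI[of _ j]) auto
  qed
  have vert: "?p k \<in> ?p ` e" if e: "e \<in> ?E" and k: "?p k \<in> path_image (?g e)" for e k
    using edge[OF e]
  proof (elim disjE exE conjE)
    fix i assume i: "e = {0, i}" "i \<in> A" "0 < i" "Min e = 0" "Max e = i"
    then have "?p k \<in> closed_segment (?p 0) (?p i)" using k by simp
    moreover have "(real i)\<^sup>2 < M" using MA i(2) .
    ultimately have "?p k = ?p i \<or> ?p k $ 2 < (?p k $ 1)\<^sup>2" using apex_segment[OF i(3)] by metis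
    then have "?p k = ?p i \<or> k = 0"
      using parabola_pt_pos[of k M] by (cases "k = 0") auto
    then show ?thesis using i by auto
  next
    fix i j assume i: "e = {i, j}" "0 < i" "i < j" "Min e = i" "Max e = j"
    have seg: "?p k \<in> closed_segment (?p i) (?p j)" using k i(4,5) by simp
    note 1 = parabola_chord[OF i(2,3) seg]
    show ?thesis
    proof (cases "k = 0")
      case True then show ?thesis using 1 i by (simp add: parabola_pt_0)
    next
      case False
      then have "(real k - real i) * (real j - real k) = 0" using 1(3) by (simp add: parabola_pt_pos)
      then show ?thesis using i by auto
    qed
  qed
  have cross: "path_image (?g e) \<inter> path_image (?g e') \<subseteq> ?p ` (e \<inter> e')"
    if e: "e \<in> ?E" "e' \<in> ?E" "e \<noteq> e'" for e e'
  proof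
    fix z assume "z \<in> path_image (?g e) \<inter> path_image (?g e')"
    then have z: "z \<in> closed_segment (?p (Min e)) (?p (Max e))"
      "z \<in> closed_segment (?p (Min e')) (?p (Max e'))" by auto
    show "z \<in> ?p ` (e \<inter> e')"
      using edge[OF e(1)] edge[OF e(2)]
    proof (elim disjE exE conjE)
      fix i j assume i: "e = {0, i}" "i \<in> A" "0 < i" "Min e = 0" "Max e = i"
        and j: "e' = {0, j}" "j \<in> A" "0 < j" "Min e' = 0" "Max e' = j"
      have "i \<noteq> j" using e(3) i(1) j(1) by blast
      then show ?thesis
        using apex_meets_apex[OF i(3) MA[OF i(2)] z(1)[unfolded i(4,5)] j(3) MA[OF j(2)] z(2)[unfolded j(4,5)]]
        unfolding i(1) j(1) by blast
    next
      fix i c d assume i: "e = {0, i}" "i \<in> A" "0 < i" "Min e = 0" "Max e = i"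
        and c: "e' = {c, d}" "0 < c" "c < d" "Min e' = c" "Max e' = d"
      show ?thesis
        using apex_meets_chord[OF i(3) MA[OF i(2)] z(1)[unfolded i(4,5)] c(2,3) z(2)[unfolded c(4,5)]]
        unfolding i(1) c(1) .
    next
      fix i c d assume i: "e' = {0, i}" "i \<in> A" "0 < i" "Min e' = 0" "Max e' = i"
        and c: "e = {c, d}" "0 < c" "c < d" "Min e = c" "Max e = d"
      show ?thesis
        using apex_meets_chord[OF i(3) MA[OF i(2)] z(2)[unfolded i(4,5)] c(2,3) z(1)[unfolded c(4,5)]]
        unfolding i(1) c(1) by (subst Int_commute)
    next
      fix a b c d assume *: "e = {a, b}" "(a, b) \<in> C" "0 < a" "a < b" "Min e = a" "Max e = b"
        "e' = {c, d}" "(c, d) \<in> C" "0 < c" "c < d" "Min e' = c" "Max e' = d"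
      have nab: "nested_or_apart a b c d" using nc *(2,8) by blast
      have "(a, b) \<noteq> (c, d)" using e(3) *(1,7) by blast
      then show ?thesis
        using chords_meet[OF *(3,4,9,10) nab _ z(1)[unfolded *(5,6)] z(2)[unfolded *(11,12)]]
        unfolding *(1,7) by blast
    qed
  qed
  show ?thesis unfolding planar_def
  proof (intro exI[of _ ?p] exI[of _ ?g] conjI ballI impI)
    show "inj_on ?p V" using inj_parabola_pt[OF M0] inj_on_subset by blast
  next
    fix e assume e: "e \<in> ?E"
    have mm: "e = {Min e, Max e} \<and> Min e \<noteq> Max e \<and> e \<subseteq> V"
      using edge[OF e] by (elim disjE exE conjE) (use A V0 in auto)
    then show "arc (?g e)" using mm by (simp add: inj)
    show ends: "{pathstart (?g e), pathfinish (?g e)} = ?p ` e" using mm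
      by (metis image_empty image_insert pathfinish_linepath pathstart_linepath)
    show "path_image (?g e) \<inter> ?p ` V = ?p ` e"
    proof
      show "path_image (?g e) \<inter> ?p ` V \<subseteq> ?p ` e" using vert[OF e] by blast
      show "?p ` e \<subseteq> path_image (?g e) \<inter> ?p ` V"
      proof
        fix z assume z: "z \<in> ?p ` e"
        then have "z = pathstart (?g e) \<or> z = pathfinish (?g e)" unfolding ends[symmetric] by blast
        then have "z \<in> path_image (?g e)"
          using pathstart_in_path_image[of "?g e"] pathfinish_in_path_image[of "?g e"] by metis
        then show "z \<in> path_image (?g e) \<inter> ?p ` V" using z mm by fast
      qed
    qed
  next
    fix e e' assume "e \<in> ?E" "e' \<in> ?E" "e \<noteq> e'"
    then show "path_image (?g e) \<inter> path_image (?g e') \<subseteq> ?p ` (e \<inter> e')" by (rule cross)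
  qed
qed

section \<open>Nested alternating fans\<close>

text \<open>A copy of depth \<open>k\<close> rooted at \<open>r\<close> uses the consecutive labels
  from \<open>r\<close> to \<open>r + fan_size k - 1\<close>. Subtrees are thus disjoint blocks of
  integers, and noncrossing becomes a statement about intervals.\<close>

fun fan_size :: "nat \<Rightarrow> nat" where
  "fan_size 0 = 1"
| "fan_size (Suc k) = 1 + 44 * fan_size k"

text \<open>A triple \<open>(a, b, s)\<close> is an edge between \<open>a < b\<close>, positive iff \<open>s\<close>. The root \<open>r\<close> sees
a path of 22 vertices by positive edges and one of 22 vertices by negative edges (joined into a single
path of 44), and every path vertex is the root of a smaller copy. The length 22 leaves room to shrink
an alternating walk 10 times from both ends.\<close>
fun fan_tree :: "nat \<Rightarrow> nat \<Rightarrow> (nat \<times> nat \<times> bool) set" where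
  "fan_tree 0 r = {}"
| "fan_tree (Suc k) r =
    (let q = (\<lambda>i. r + 1 + i * fan_size k) in
      (\<lambda>i. (r, q i, i < 22)) ` {..<44} \<union>
      (\<lambda>i. (q i, q (Suc i), even i)) ` {..<43} \<union>
      (\<Union>i<44. fan_tree k (q i)))"

lemma fan_tree_SucI:
  "i < 44 \<Longrightarrow> (r, r + 1 + i * fan_size k, i < 22) \<in> fan_tree (Suc k) r"
  "i < 43 \<Longrightarrow> (r + 1 + i * fan_size k, r + 1 + Suc i * fan_size k, even i) \<in> fan_tree (Suc k) r"
  "i < 44 \<Longrightarrow> x \<in> fan_tree k (r + 1 + i * fan_size k) \<Longrightarrow> x \<in> fan_tree (Suc k) r"
  unfolding fan_tree.simps Let_def by blast+

lemma fan_size_pos: "0 < fan_size k"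
  by (cases k) auto

lemma fan_tree_bounds: "(a, b, s) \<in> fan_tree k r \<Longrightarrow> r \<le> a \<and> a < b \<and> b < r + fan_size k"
proof (induction k arbitrary: a b s r)
  case 0 then show ?case by simp
next
  case (Suc k)
  define t where "t = fan_size k"
  have t: "0 < t" by (simp add: t_def fan_size_pos)
  have le: "i * t + t \<le> 44 * t" if "i < 44" for i
    using mult_le_mono1[of "Suc i" 44 t] that by simp
  from Suc.prems consider i where "i < 44" "a = r" "b = r + 1 + i * t"
    | i where "i < 43" "a = r + 1 + i * t" "b = r + 1 + (i * t + t)"
    | i where "i < 44" "(a, b, s) \<in> fan_tree k (r + 1 + i * t)"
    by (auto simp: Let_def t_def algebra_simps)
  then show ?case
  proof cases
    case 1 then show ?thesis using le[of i] t by (simp flip: t_def)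
  next
    case 2 then show ?thesis using le[of "Suc i"] t by (simp flip: t_def)
  next
    case 3 then show ?thesis using le[of i] t Suc.IH[OF 3(2)] unfolding fan_size.simps t_def[symmetric] by linarith
  qed
qed

text \<open>The first conjunct feeds the planar drawing. The second says that no chord carries both
  signs, which is needed once the signs are stored as a set of negative edges.\<close>

lemma fan_tree_nested:
  "(a, b, s) \<in> fan_tree k r \<Longrightarrow> (c, d, t) \<in> fan_tree k r \<Longrightarrow>
    nested_or_apart a b c d \<and> (a = c \<and> b = d \<longrightarrow> s = t)"
proof (induction k arbitrary: a b s c d t r)
  case 0 then show ?case by simp
next
  case (Suc k)
  define q where "q i = r + 1 + i * fan_size k" for i
  have q0: "r < q i" for i by (simp add: q_def)
  have q1: "q i < q (Suc i)" for i using fan_size_pos[of k] by (simp add: q_def)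
  have q2: "q (Suc i) \<le> q j" if "i < j" for i j
    using mult_le_mono1[of "Suc i" j "fan_size k"] that unfolding q_def by simp
  \<comment> \<open>Each triple gets the index of its block: its ends lie in \<open>r\<close>
    together with the interval from \<open>q i\<close> to \<open>q (Suc i)\<close>. Distinct indices
    then need only the order of the \<open>q i\<close>, and induction is left for two edges inside
    one block.\<close>
  have mem: "\<exists>i. (a = r \<and> b = q i \<and> s = (i < 22)) \<or> (a = q i \<and> b = q (Suc i) \<and> s = even i) \<or>
      ((a, b, s) \<in> fan_tree k (q i) \<and> q i \<le> a \<and> a < b \<and> b < q (Suc i))"
    if h: "(a, b, s) \<in> fan_tree (Suc k) r" for a b s
  proof -
    have "(\<exists>i. a = r \<and> b = q i \<and> s = (i < 22)) \<or> (\<exists>i. a = q i \<and> b = q (Suc i) \<and> s = even i) \<or>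
      (\<exists>i. (a, b, s) \<in> fan_tree k (q i))"
      using h by (auto simp: Let_def q_def)
    moreover have "q i \<le> a \<and> a < b \<and> b < q (Suc i)" if "(a, b, s) \<in> fan_tree k (q i)" for i
      using fan_tree_bounds[OF that] by (simp add: q_def algebra_simps)
    ultimately show ?thesis by blast
  qed
  obtain i where i: "(a = r \<and> b = q i \<and> s = (i < 22)) \<or> (a = q i \<and> b = q (Suc i) \<and> s = even i) \<or>
      ((a, b, s) \<in> fan_tree k (q i) \<and> q i \<le> a \<and> a < b \<and> b < q (Suc i))"
    using mem[OF Suc.prems(1)] by blast
  obtain j where j: "(c = r \<and> d = q j \<and> t = (j < 22)) \<or> (c = q j \<and> d = q (Suc j) \<and> t = even j) \<or>
      ((c, d, t) \<in> fan_tree k (q j) \<and> q j \<le> c \<and> c < d \<and> d < q (Suc j))"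
    using mem[OF Suc.prems(2)] by blast
  consider "i < j" | "j < i" | "i = j" by linarith
  then show ?case
  proof cases
    case 1
    then show ?thesis using i j q0[of i] q0[of j] q1[of i] q1[of j] q2[OF 1]
      unfolding nested_or_apart_def by (elim disjE) simp_all
  next
    case 2
    then show ?thesis using i j q0[of i] q0[of j] q1[of i] q1[of j] q2[OF 2]
      unfolding nested_or_apart_def by (elim disjE) simp_all
  next
    case 3
    show ?thesis
    proof (cases "(a, b, s) \<in> fan_tree k (q i) \<and> (c, d, t) \<in> fan_tree k (q i)")
      case True then show ?thesis using Suc.IH by blast
    next
      case False
      then show ?thesis using i j[folded 3] q0[of i] q1[of i]
        unfolding nested_or_apart_def by (elim disjE) simp_all
    qed
  qed
qed

section \<open>Decreasing set sequences and two-coloured graphs on at most nine vertices\<close>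

lemma decreasing_sets_stabilize:
  fixes A :: "nat \<Rightarrow> 'b set"
  assumes "finite (A 0)" "\<And>i. A (Suc i) \<subseteq> A i" "card (A 0) \<le> c"
  shows "\<exists>i\<le>c. A (Suc i) = A i"
proof (rule ccontr)
  assume ne: "\<not> ?thesis"
  have fin: "finite (A i)" for i
    using assms(1,2) by (induction i) (auto intro: finite_subset)
  \<comment> \<open>Each strict inclusion costs an element, so \<open>c + 1\<close> of them cannot
    occur.\<close>
  have "card (A i) + i \<le> c" if "i \<le> Suc c" for i
    using that
  proof (induction i)
    case 0 then show ?case using assms(3) by simp
  next
    case (Suc i)
    then have "A (Suc i) \<subset> A i" using ne assms(2)[of i] by auto
    then have "card (A (Suc i)) < card (A i)" using fin psubset_card_mono by blast
    then show ?case using Suc by simp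
  qed
  from this[of "Suc c"] show False by simp
qed

lemma antimono_chain:
  fixes A :: "nat \<Rightarrow> 'b set"
  assumes "\<And>i. A (Suc i) \<subseteq> A i" "i \<le> j"
  shows "A j \<subseteq> A i"
  using assms(2) by (induction rule: dec_induct) (use assms(1) in auto)

text \<open>Models the neighbourhood of the image of the apex, with pairs coloured by the sign of
  their triangle through that image. Pairs may be uncoloured; completeness is a conclusion
  below.\<close>

locale signed_relation =
  fixes A :: "'v set" and R :: "bool \<Rightarrow> 'v \<Rightarrow> 'v \<Rightarrow> bool"
  assumes finite_A: "finite A"
    and card_A_le: "card A \<le> 9"
    and R_sym: "R s x y \<Longrightarrow> R s y x"
    and R_irrefl: "\<not> R s x x"
    and R_unique: "R s x y \<Longrightarrow> R t x y \<Longrightarrow> s = t"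
    and R_dom: "R s x y \<Longrightarrow> x \<in> A"
begin

text \<open>One layer of the fan tree seen in the target: \<open>u\<close> survives if it can be the
  image of a root whose path vertices map into \<open>W\<close>. The sequence \<open>x\<close> is a
  walk, so repetitions are allowed.\<close>

definition fan_op :: "'v set \<Rightarrow> 'v set" where
  "fan_op W = {u \<in> A. \<forall>s. \<exists>x :: nat \<Rightarrow> 'v.
     (\<forall>i<22. x i \<in> W \<and> R s u (x i)) \<and> (\<forall>i<21. R (even i) (x i) (x (Suc i)))}"

lemma fan_opI:
  assumes "u \<in> A"
    and "\<And>s. \<exists>x :: nat \<Rightarrow> 'v. (\<forall>i<22. x i \<in> W \<and> R s u (x i)) \<and> (\<forall>i<21. R (even i) (x i) (x (Suc i)))"
  shows "u \<in> fan_op W"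
  using assms unfolding fan_op_def by blast

lemma fan_op_mono: "W \<subseteq> W' \<Longrightarrow> fan_op W \<subseteq> fan_op W'"
  unfolding fan_op_def by blast

lemma fan_op_funpow_decreasing: "(fan_op ^^ Suc k) A \<subseteq> (fan_op ^^ k) A"
proof (induction k)
  case 0 show ?case by (auto simp: fan_op_def)
next
  case (Suc k)
  then have "fan_op ((fan_op ^^ Suc k) A) \<subseteq> fan_op ((fan_op ^^ k) A)" by (rule fan_op_mono)
  then show ?case by simp
qed

text \<open>Induction on depth: the path vertices are roots of smaller copies, hence land in the
  previous iterate. The first 22 serve as the walk for \<open>True\<close>, the last 22 as the walk
  for \<open>False\<close>.\<close>

lemma fan_tree_hom_root:
  assumes "\<And>a b s. (a, b, s) \<in> fan_tree k r \<Longrightarrow> R s (f a) (f b)"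
    and "\<And>a. r \<le> a \<Longrightarrow> a < r + fan_size k \<Longrightarrow> f a \<in> A"
  shows "f r \<in> (fan_op ^^ k) A"
  using assms
proof (induction k arbitrary: r)
  case 0 then show ?case by simp
next
  case (Suc k)
  define q where "q i = r + 1 + i * fan_size k" for i
  have size: "q i + fan_size k \<le> r + fan_size (Suc k)" if "i < 44" for i
    using mult_le_mono1[of "Suc i" 44 "fan_size k"] that by (simp add: q_def)
  note I = fan_tree_SucI[where k=k and r=r, folded q_def]
  have W: "f (q i) \<in> (fan_op ^^ k) A" if i: "i < 44" for i
  proof -
    have edges: "R s (f a) (f b)" if "(a, b, s) \<in> fan_tree k (q i)" for a b s
      by (rule Suc.prems(1)[OF I(3)[OF i that]])
    have verts: "f a \<in> A" if "q i \<le> a" "a < q i + fan_size k" for a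
    proof (rule Suc.prems(2))
      show "r \<le> a" using that(1) unfolding q_def by linarith
      show "a < r + fan_size (Suc k)" using that(2) size[OF i] by linarith
    qed
    show ?thesis by (rule Suc.IH[OF edges verts])
  qed
  have "f r \<in> fan_op ((fan_op ^^ k) A)"
  proof (rule fan_opI)
    show "f r \<in> A" using Suc.prems(2)[of r] by simp
    fix s
    show "\<exists>x. (\<forall>i<22. x i \<in> (fan_op ^^ k) A \<and> R s (f r) (x i)) \<and>
        (\<forall>i<21. R (even i) (x i) (x (Suc i)))"
    proof (cases s)
      case True
      have "R True (f r) (f (q i))" if "i < 22" for i
        using Suc.prems(1)[OF I(1)[of i]] that by simp
      moreover have "R (even i) (f (q i)) (f (q (Suc i)))" if "i < 21" for i
        using that by (intro Suc.prems(1)[OF I(2)]) simp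
      ultimately show ?thesis using W True
        by (intro exI[of _ "\<lambda>i. f (q i)"]) simp
    next
      case False
      have "R False (f r) (f (q (22 + i)))" if "i < 22" for i
        using Suc.prems(1)[OF I(1)[of "22 + i"]] that by simp
      \<comment> \<open>The shift by 22 is even, so the alternation keeps its phase.\<close>
      moreover have "R (even i) (f (q (22 + i))) (f (q (22 + Suc i)))" if "i < 21" for i
        using Suc.prems(1)[OF I(2)[of "22 + i"]] that by simp
      ultimately show ?thesis using W False
        by (intro exI[of _ "\<lambda>i. f (q (22 + i))"]) simp
    qed
  qed
  then show ?case by simp
qed

definition bichromatic :: "'v set \<Rightarrow> bool" where
  "bichromatic W \<longleftrightarrow> W \<noteq> {} \<and> (\<forall>v\<in>W. \<forall>s. \<exists>w\<in>W. R s v w)"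

lemma alternating_walk_core:
  assumes N: "N \<subseteq> A" and x: "\<And>i. i < 22 \<Longrightarrow> x i \<in> N"
    and alt: "\<And>i. i < 21 \<Longrightarrow> R (even i) (x i) (x (Suc i))"
  shows "\<exists>W\<subseteq>N. bichromatic W"
proof -
  \<comment> \<open>Every vertex of \<open>B (Suc i)\<close> has neighbours of both colours in \<open>B i\<close>, so a repetition
    \<open>B (Suc i) = B i\<close> gives the desired set.\<close>
  define B where "B i = {x j | j. i \<le> j \<and> j + i < 22}" for i
  have dec: "B (Suc i) \<subseteq> B i" for i unfolding B_def by fastforce
  have BN: "B i \<subseteq> N" for i unfolding B_def using x by fastforce
  have "B 0 \<subseteq> A" using BN N by blast
  then have fin: "finite (B 0)" "card (B 0) \<le> 9"
    using finite_A card_A_le by (auto intro: finite_subset dest: card_mono[OF finite_A])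
  obtain i where i: "i \<le> 9" "B (Suc i) = B i"
    using decreasing_sets_stabilize[of B 9, OF fin(1) dec fin(2)] by blast
  show ?thesis
    unfolding bichromatic_def
  proof (intro exI[of _ "B i"] conjI ballI allI)
    show "B i \<subseteq> N" by (rule BN)
    \<comment> \<open>Since \<open>i <= 9\<close>, we have i + i < 22, so the shrunken window is not
      yet empty.\<close>
    have "x i \<in> B i" using i(1) by (auto simp: B_def)
    then show "B i \<noteq> {}" by blast
    fix v s assume "v \<in> B i"
    then have "v \<in> B (Suc i)" using i(2) by simp
    then obtain j where j: "v = x j" "Suc i \<le> j" "j + Suc i < 22" by (auto simp: B_def)
    then obtain l where l: "j = Suc l" by (cases j) auto
    have "x l \<in> B i" "x (Suc j) \<in> B i" using j l by (auto simp: B_def)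
    moreover have "R (even l) v (x l)" using R_sym[OF alt[of l]] j l by simp
    moreover have "R (even j) v (x (Suc j))" using alt[of j] j by simp
    moreover have "even j = (\<not> even l)" using l by simp
    ultimately show "\<exists>w\<in>B i. R s v w" by (cases "s = even j") auto
  qed
qed

text \<open>Three vertices are too few: if \<open>x y\<close> is positive and \<open>x z\<close>
  negative, the negative neighbour of \<open>y\<close> could only be \<open>z\<close>, and then
  \<open>z\<close> has no positive neighbour.\<close>

lemma bichromatic_card:
  assumes "finite W" "bichromatic W"
  shows "4 \<le> card W"
proof -
  have W: "\<exists>w\<in>W. R s v w" if "v \<in> W" for v s using assms(2) that by (simp add: bichromatic_def)
  obtain x where x: "x \<in> W" using assms(2) by (auto simp: bichromatic_def)
  obtain y where y: "y \<in> W" "R True x y" using W[OF x] by blast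
  obtain z where z: "z \<in> W" "R False x z" using W[OF x] by blast
  have ne: "x \<noteq> y" "x \<noteq> z" "y \<noteq> z" using y z R_irrefl R_unique by blast+
  have "\<exists>w\<in>W. w \<notin> {x, y, z}"
  proof (rule ccontr)
    assume "\<not> ?thesis"
    then have Weq: "W \<subseteq> {x, y, z}" by blast
    obtain v where v: "v \<in> W" "R False y v" using W[OF y(1)] by blast
    then have "v = z" using Weq R_irrefl R_unique y(2) R_sym by blast
    obtain w where w: "w \<in> W" "R True z w" using W[OF z(1)] by blast
    have "w \<noteq> x" using w(2) z(2) R_sym R_unique by blast
    moreover have "w \<noteq> y" using w(2) v(2) \<open>v = z\<close> R_sym R_unique by blast
    ultimately show False using w Weq R_irrefl by blast
  qed
  then obtain w where "w \<in> W" "w \<notin> {x, y, z}" by blast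
  then have "{w, x, y, z} \<subseteq> W" "card {w, x, y, z} = 4" using x y z ne by auto
  then show ?thesis using card_mono[OF assms(1)] by metis
qed

text \<open>At \<open>u\<close> in \<open>U\<close> each colour neighbourhood contains a bichromatic
  core inside \<open>U\<close> of size at least 4, while at most eight other vertices exist.
  Equality throughout makes each neighbourhood equal to its core, so it inherits the core's
  property.\<close>

lemma fan_op_fixpoint_paley:
  assumes U: "fan_op U = U" "U \<noteq> {}"
  shows "card A = 9" "\<And>x y. x \<in> A \<Longrightarrow> y \<in> A \<Longrightarrow> x \<noteq> y \<Longrightarrow> \<exists>s. R s x y"
    "\<And>x s. x \<in> A \<Longrightarrow> card {y. R s x y} = 4"
    "\<And>x y s t. R s x y \<Longrightarrow> \<exists>z. R s x z \<and> R t y z"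
proof -
  have "fan_op U \<subseteq> A" by (auto simp: fan_op_def)
  then have UA: "U \<subseteq> A" unfolding U(1) .
  have NA: "{y. R s u y} \<subseteq> A - {u}" for s u using R_dom[OF R_sym] R_irrefl by auto
  then have finN: "finite {y. R s u y}" for s u using finite_A finite_subset by blast
  have core: "\<exists>W\<subseteq>{y \<in> U. R s u y}. 4 \<le> card W \<and> bichromatic W"
    if u: "u \<in> U" for u s
  proof -
    have "u \<in> fan_op U" using u U(1) by simp
    then obtain x where x: "\<And>i. i < 22 \<Longrightarrow> x i \<in> U \<and> R s u (x i)"
      "\<And>i. i < 21 \<Longrightarrow> R (even i) (x i) (x (Suc i))"
      unfolding fan_op_def by blast
    have "\<exists>W\<subseteq>{y \<in> U. R s u y}. bichromatic W"
    proof (rule alternating_walk_core)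
      show "{y \<in> U. R s u y} \<subseteq> A" using UA by blast
      show "x i \<in> {y \<in> U. R s u y}" if "i < 22" for i using x(1)[OF that] by blast
      show "R (even i) (x i) (x (Suc i))" if "i < 21" for i by (rule x(2)[OF that])
    qed
    then obtain W where W: "W \<subseteq> {y \<in> U. R s u y}" "bichromatic W" by auto
    have "{y \<in> U. R s u y} \<subseteq> A" using UA by blast
    then have "finite W" using finite_subset[OF W(1) finite_subset[OF _ finite_A]] by simp
    then have "4 \<le> card W" using W(2) by (rule bichromatic_card)
    then show ?thesis using W by (intro exI[of _ W] conjI)
  qed
  have N4: "4 \<le> card {y. R s u y}" if u: "u \<in> U" for u s
  proof -
    obtain W where W: "W \<subseteq> {y \<in> U. R s u y}" "4 \<le> card W" using core[OF u] by auto
    then have "W \<subseteq> {y. R s u y}" by blast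
    then show ?thesis using card_mono[OF finN, of W s u] W(2) by simp
  qed
  have all: "card A = 9 \<and> A - {u} = {y. R True u y} \<union> {y. R False u y} \<and>
      (\<forall>s. card {y. R s u y} = 4)" if u: "u \<in> U" for u
  proof -
    have dis: "{y. R True u y} \<inter> {y. R False u y} = {}" using R_unique by blast
    have sub: "{y. R True u y} \<union> {y. R False u y} \<subseteq> A - {u}" using NA by blast
    have cu: "card (A - {u}) = card A - 1" "0 < card A"
      using u UA finite_A by (auto simp: card_gt_0_iff)
    have c: "card ({y. R True u y} \<union> {y. R False u y}) = card {y. R True u y} + card {y. R False u y}"
      by (rule card_Un_disjoint[OF finN finN dis])
    moreover have "\<dots> \<ge> 8" using N4[OF u, of True] N4[OF u, of False] by simp
    moreover have "card ({y. R True u y} \<union> {y. R False u y}) \<le> card (A - {u})"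
      using sub finite_A by (intro card_mono) auto
    ultimately have 9: "card A = 9" and 8: "card {y. R True u y} + card {y. R False u y} = 8"
      using cu card_A_le by linarith+
    have "card {y. R True u y} = 4" "card {y. R False u y} = 4"
      using 8 N4[OF u, of True] N4[OF u, of False] by linarith+
    then have "card {y. R s u y} = 4" for s by (cases s) simp_all
    moreover have "{y. R True u y} \<union> {y. R False u y} = A - {u}"
      using sub c 8 9 cu finite_A by (intro card_subset_eq) auto
    ultimately show ?thesis using 9 by simp
  qed
  have coreN: "{y. R s u y} \<subseteq> U \<and> (\<forall>v t. R s u v \<longrightarrow> (\<exists>w. R s u w \<and> R t v w))"
    if u: "u \<in> U" for s u
  proof -
    obtain W where W: "W \<subseteq> {y \<in> U. R s u y}" "4 \<le> card W" "bichromatic W"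
      using core[OF u] by auto
    have c: "card {y. R s u y} = 4" using all[OF u] by blast
    have sub: "W \<subseteq> {y. R s u y}" using W(1) by blast
    have "card W = card {y. R s u y}" using card_mono[OF finN sub] W(2) c by simp
    then have "W = {y. R s u y}" by (rule card_subset_eq[OF finN sub])
    then show ?thesis using W(1,3) unfolding bichromatic_def by blast
  qed
  \<comment> \<open>Every vertex of \<open>A\<close> other than \<open>u\<close> is a neighbour of
    \<open>u\<close>, and neighbours of \<open>u\<close> lie in \<open>U\<close>. The facts shown at
    points of \<open>U\<close> therefore hold on all of \<open>A\<close>.\<close>
  have "U = A"
  proof -
    obtain u where u: "u \<in> U" using U(2) by blast
    have "A - {u} = {y. R True u y} \<union> {y. R False u y}" using all[OF u] by blast
    moreover have "{y. R s u y} \<subseteq> U" for s using coreN[OF u] by blast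
    ultimately have "A - {u} \<subseteq> U" by blast
    then show ?thesis using u UA by blast
  qed
  note UA = this
  show "card A = 9" using all U(2) by blast
  show "\<exists>s. R s x y" if "x \<in> A" "y \<in> A" "x \<noteq> y" for x y
    using all[of x] that unfolding UA by blast
  show "card {y. R s x y} = 4" if "x \<in> A" for x s using all[of x] that unfolding UA by blast
  show "\<exists>z. R s x z \<and> R t y z" if "R s x y" for x y s t
    using coreN[of x s] that R_dom UA by blast
qed

text \<open>The iterates start with at most 9 elements, so they repeat at some
  \<open>k <= 9\<close>. Depth 10 puts \<open>f r\<close> into an iterate contained in the repeated
  set, which is therefore nonempty.\<close>

lemma fan_tree_hom_fixpoint:
  assumes "\<And>a b s. (a, b, s) \<in> fan_tree 10 r \<Longrightarrow> R s (f a) (f b)"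
    and "\<And>a. r \<le> a \<Longrightarrow> a < r + fan_size 10 \<Longrightarrow> f a \<in> A"
  obtains U where "fan_op U = U" "U \<noteq> {}"
proof -
  let ?B = "\<lambda>k. (fan_op ^^ k) A"
  obtain k where k: "k \<le> 9" "?B (Suc k) = ?B k"
    using decreasing_sets_stabilize[of ?B 9] fan_op_funpow_decreasing finite_A card_A_le by auto
  have "f r \<in> ?B 10" using fan_tree_hom_root[of 10 r f] assms by blast
  moreover have "?B 10 \<subseteq> ?B k"
    by (rule antimono_chain) (use fan_op_funpow_decreasing k in auto)
  ultimately show thesis using that[of "?B k"] k by auto
qed

end

section \<open>Uniqueness of the Paley graph of order 9\<close>

lemma F9_eq: "F9 = {(0,0), (0,1), (0,2), (1,0), (1,1), (1,2), (2,0), (2,1), (2,2)}"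
proof -
  have "{0..2::int} = {0, 1, 2}" by auto
  then show ?thesis unfolding F9_def by (simp only: insert_Times_insert Sigma_empty1 Times_empty) auto
qed

text \<open>The nonzero squares are the four elements 1, -1, i, -i; for instance (1 + i)^2 = 2i.
  Together with 0 they are exactly the points on the two axes.\<close>

lemma F9_square_iff:
  assumes "x \<in> F9"
  shows "F9_square x \<longleftrightarrow> fst x = 0 \<or> snd x = 0"
proof -
  have "F9_square x \<longleftrightarrow> x \<in> {(0,0), (1,0), (2,0), (0,1), (0,2)}"
    unfolding F9_square_def F9_eq by (simp add: F9_mult_def) argo
  moreover have "x \<in> {(0,0), (0,1), (0,2), (1,0), (1,1), (1,2), (2,0), (2,1), (2,2)}"
    using assms unfolding F9_eq .
  ultimately show ?thesis
    by (simp only: insert_iff empty_iff simp_thms) (elim disjE; simp)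
qed

text \<open>This turns the positive edges of \<open>SP9\<close> into the rook moves of the grid, the
  form in which the graph is recognised below.\<close>

lemma F9_square_sub_iff:
  assumes "x \<in> F9" "y \<in> F9"
  shows "F9_square (F9_sub y x) \<longleftrightarrow> fst x = fst y \<or> snd x = snd y"
proof -
  have "F9_sub y x \<in> F9" by (auto simp: F9_sub_def F9_def)
  moreover have "(a - b) mod 3 = 0 \<longleftrightarrow> b = a" if "a \<in> {0..2}" "b \<in> {0..2}" for a b :: int
    using that unfolding atLeastAtMost_iff by presburger
  ultimately show ?thesis
    using assms F9_square_iff[of "F9_sub y x"] unfolding F9_sub_def F9_def
    by (simp only: fst_conv snd_conv mem_Times_iff)
qed

text \<open>The last two axioms are only lower bounds: a third vertex for each edge, and a third
  vertex for each non-edge in the complement. Counting sharpens them to the strongly regular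
  parameters (9, 4, 1, 2).\<close>

locale paley_nine =
  fixes A :: "'v set" and P :: "'v \<Rightarrow> 'v \<Rightarrow> bool"
  assumes finite_A: "finite A" and card_A: "card A = 9"
    and P_sym: "P x y \<Longrightarrow> P y x"
    and P_irrefl: "\<not> P x x"
    and P_dom: "P x y \<Longrightarrow> x \<in> A \<and> y \<in> A"
    and degree: "x \<in> A \<Longrightarrow> card {y. P x y} = 4"
    and triangle: "P x y \<Longrightarrow> \<exists>z. P x z \<and> P y z"
    and cotriangle: "x \<in> A \<Longrightarrow> y \<in> A \<Longrightarrow> x \<noteq> y \<Longrightarrow> \<not> P x y \<Longrightarrow>
      \<exists>z\<in>A. z \<noteq> x \<and> z \<noteq> y \<and> \<not> P x z \<and> \<not> P y z"
begin

lemma nbrs_finite: "finite {y. P x y}"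
  by (rule finite_subset[OF _ finite_A]) (auto dest: P_dom)

lemma common_nbrs:
  assumes u: "u \<in> A"
  shows "\<And>x. P u x \<Longrightarrow> card {z. P u z \<and> P x z} = 1"
    and "\<And>y. y \<in> A \<Longrightarrow> y \<noteq> u \<Longrightarrow> \<not> P u y \<Longrightarrow> card {z. P u z \<and> P y z} = 2"
proof -
  define N where "N = {y. P u y}"
  define M where "M = A - {u} - N"
  have N: "finite N" "card N = 4" "N \<subseteq> A - {u}"
    using nbrs_finite degree[OF u] P_dom P_irrefl by (auto simp: N_def)
  have M: "finite M" "card M = 4"
    using N finite_A card_A u by (auto simp: M_def card_Diff_subset)
  let ?n = "\<lambda>x. card {z \<in> N. P x z}" and ?m = "\<lambda>x. card {z \<in> M. P x z}"
  have degN: "?n x + ?m x = 3" if x: "x \<in> N" for x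
  proof -
    let ?B = "{z \<in> N. P x z} \<union> {z \<in> M. P x z}"
    have eq: "{z. P x z} = insert u ?B"
      using x P_sym[of u x] P_dom[of x] by (auto simp: N_def M_def)
    have B: "card ?B = ?n x + ?m x"
      using N(1) M(1) by (intro card_Un_disjoint) (auto simp: M_def)
    have u: "finite ?B" "u \<notin> ?B" using N M by (auto simp: M_def)
    have "card {z. P x z} = Suc (?n x + ?m x)"
      unfolding eq B[symmetric] by (rule card_insert_disjoint[OF u])
    moreover have "x \<in> A" using x N(3) by blast
    then have "card {z. P x z} = 4" by (rule degree)
    ultimately show ?thesis by linarith
  qed
  have n1: "1 \<le> ?n x" if x: "x \<in> N" for x
  proof -
    have "{z \<in> N. P x z} \<noteq> {}" using triangle[of u x] x by (auto simp: N_def)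
    then show ?thesis using N(1) by (simp add: Suc_le_eq card_gt_0_iff)
  qed
  \<comment> \<open>The vertex \<open>z\<close> supplied by \<open>cotriangle\<close> lies in
    \<open>M\<close> and is not adjacent to \<open>y\<close>. So \<open>y\<close> has at most two
    neighbours in \<open>M\<close>, and the rest of its four lie in \<open>N\<close>.\<close>
  have n2: "2 \<le> ?n y" if y: "y \<in> M" for y
  proof -
    have yA: "y \<in> A" "y \<noteq> u" "\<not> P u y" using y by (auto simp: M_def N_def)
    obtain z where z: "z \<in> A" "z \<noteq> u" "z \<noteq> y" "\<not> P u z" "\<not> P y z"
      using cotriangle[OF u yA(1)] yA by auto
    have "{w \<in> M. P y w} \<subseteq> M - {y, z}" using z P_irrefl by auto
    then have "?m y \<le> card (M - {y, z})" using M(1) by (intro card_mono) auto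
    also have "\<dots> = 2" using y z M by (auto simp: M_def N_def card_Diff_subset)
    finally have "?m y \<le> 2" .
    have eq: "{w. P y w} = {w \<in> N. P y w} \<union> {w \<in> M. P y w}"
      using yA P_sym[of y u] P_dom[of y] by (auto simp: M_def)
    have "card {w. P y w} = ?n y + ?m y"
      unfolding eq using N(1) M(1) by (intro card_Un_disjoint) (auto simp: M_def)
    then show ?thesis using degree[OF yA(1)] \<open>?m y \<le> 2\<close> by linarith
  qed
  \<comment> \<open>Both sides count the \<open>P\<close>-edges between \<open>N\<close> and \<open>M\<close>: at most 8 seen from \<open>N\<close>, at least 8 seen
    from \<open>M\<close>.\<close>
  have swap: "(\<Sum>x\<in>N. ?m x) = (\<Sum>y\<in>M. ?n y)"
  proof (rule sum_multicount_gen[OF N(1) M(1)])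
    have "{x \<in> N. P x y} = {z \<in> N. P y z}" for y using P_sym by blast
    then show "\<forall>y\<in>M. card {x \<in> N. P x y} = ?n y" by simp
  qed
  have "(\<Sum>y\<in>M. 2) \<le> (\<Sum>y\<in>M. ?n y)" by (rule sum_mono) (rule n2)
  then have ge: "8 \<le> (\<Sum>y\<in>M. ?n y)" using M by simp
  have m2: "?m x \<le> 2" if "x \<in> N" for x using degN[OF that] n1[OF that] by linarith
  have "(\<Sum>x\<in>N. ?m x) \<le> (\<Sum>x\<in>N. 2)" by (rule sum_mono) (rule m2)
  then have le: "(\<Sum>x\<in>N. ?m x) \<le> 8" using N by simp
  have eqN: "?m x = 2" if x: "x \<in> N" for x
  proof (rule ccontr)
    assume "?m x \<noteq> 2"
    then have "?m x < 2" using m2[OF x] by linarith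
    then have "(\<Sum>x\<in>N. ?m x) < (\<Sum>x\<in>N. 2)"
      using x m2 N(1) by (intro sum_strict_mono_ex1) blast+
    then show False using ge swap N by simp
  qed
  have eqM: "?n y = 2" if y: "y \<in> M" for y
  proof (rule ccontr)
    assume "?n y \<noteq> 2"
    then have "2 < ?n y" using n2[OF y] by linarith
    then have "(\<Sum>y\<in>M. 2) < (\<Sum>y\<in>M. ?n y)"
      using y n2 M(1) by (intro sum_strict_mono_ex1) blast+
    then show False using le swap M by simp
  qed
  have Neq: "{z \<in> N. P x z} = {z. P u z \<and> P x z}" for x by (auto simp: N_def)
  show "card {z. P u z \<and> P x z} = 1" if "P u x" for x
    using eqN[of x] degN[of x] that by (simp add: N_def)
  show "card {z. P u z \<and> P y z} = 2" if "y \<in> A" "y \<noteq> u" "\<not> P u y" for y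
    using eqM[of y] that by (simp add: M_def N_def)
qed

lemma common_nbr_unique: "P u x \<Longrightarrow> P u z \<Longrightarrow> P x z \<Longrightarrow> P u w \<Longrightarrow> P x w \<Longrightarrow> z = w"
proof -
  assume h: "P u x" "P u z" "P x z" "P u w" "P x w"
  have "u \<in> A" using h(1) P_dom by blast
  then have "card {z. P u z \<and> P x z} = 1" using h(1) by (rule common_nbrs(1))
  then obtain v where v: "{z. P u z \<and> P x z} = {v}" by (rule card_1_singletonE)
  have "z \<in> {v}" "w \<in> {v}" unfolding v[symmetric] using h by simp_all
  then show "z = w" by simp
qed

text \<open>The pair \<open>a\<close>, \<open>b\<close> has two common neighbours: \<open>u\<close>
  and a second one, \<open>p\<close>. If \<open>p\<close> were adjacent to \<open>u\<close>, the
  edge \<open>u p\<close> would lie in two triangles, with third vertices \<open>a\<close> and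
  \<open>b\<close>.\<close>

lemma nonadjacent_common_nbr:
  assumes "P u a" "P u b" "\<not> P a b" "a \<noteq> b"
  obtains p where "P a p" "P b p" "p \<noteq> u" "\<not> P u p"
proof -
  have "a \<in> A" "b \<in> A" using assms P_dom by blast+
  then have "card {z. P a z \<and> P b z} = 2" using common_nbrs(2)[of a b] assms by simp
  moreover have "u \<in> {z. P a z \<and> P b z}" using assms P_sym by blast
  ultimately obtain p where p: "p \<noteq> u" "P a p" "P b p"
    by (metis (mono_tags, lifting) card_2_iff' mem_Collect_eq)
  have "\<not> P u p"
  proof
    assume "P u p"
    have "P p a" "P p b" "P p u" using p P_sym \<open>P u p\<close> by blast+
    then show False
      using common_nbr_unique[of u p a b] assms \<open>P u p\<close> by blast
  qed
  then show thesis using that p by blast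
qed

lemma nbrs_eq:
  assumes "distinct [a, b, c, d]" "P x a" "P x b" "P x c" "P x d"
  shows "{y. P x y} = {a, b, c, d}"
proof -
  have "{a, b, c, d} \<subseteq> {y. P x y}" using assms by blast
  moreover have "x \<in> A" using assms(2) P_dom by blast
  then have "card {a, b, c, d} = card {y. P x y}" using assms(1) degree[of x] by simp
  ultimately have "{a, b, c, d} = {y. P x y}" by (rule card_subset_eq[OF nbrs_finite])
  then show ?thesis by (rule sym)
qed

text \<open>The rows of the grid are \<open>u a a'\<close>, \<open>b p r\<close> and
  \<open>b' q s\<close>. Two triangles at \<open>u\<close> give the first row and first column, and
  each other cell is the second common neighbour of its row and column heads.\<close>

lemma rook_grid:
  obtains u a a' b b' p q r s where
    "A = {u, a, a', b, b', p, q, r, s}" "distinct [u, a, a', b, b', p, q, r, s]"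
    "{y. P u y} = {a, a', b, b'}"
    "{y. P a y} = {u, a', p, q}"
    "{y. P a' y} = {u, a, r, s}"
    "{y. P b y} = {u, b', p, r}"
    "{y. P b' y} = {u, b, q, s}"
    "{y. P p y} = {a, b, q, r}"
    "{y. P q y} = {a, b', p, s}"
    "{y. P r y} = {a', b, p, s}"
    "{y. P s y} = {a', b', q, r}"
proof -
  have sym: "P x y = P y x" for x y using P_sym by blast
  have uniq: "z = w" if "P u x" "P u z" "P x z" "P u w" "P x w" for u x z w
    using common_nbr_unique that by blast
  have "A \<noteq> {}" using card_A by auto
  then obtain u where u: "u \<in> A" by blast
  have "{y. P u y} \<noteq> {}" using degree[OF u] by (metis card.empty zero_neq_numeral)
  then obtain a where a: "P u a" by blast
  obtain a' where a': "P u a'" "P a a'" using triangle[OF a] by blast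
  have aa': "a \<noteq> a'" using a' P_irrefl by blast
  have "\<not> {y. P u y} \<subseteq> {a, a'}"
  proof
    assume "{y. P u y} \<subseteq> {a, a'}"
    then have "card {y. P u y} \<le> card {a, a'}" by (intro card_mono) auto
    then show False using degree[OF u] aa' by simp
  qed
  then obtain b where b: "P u b" "b \<noteq> a" "b \<noteq> a'" by blast
  obtain b' where b': "P u b'" "P b b'" using triangle[OF b(1)] by blast
  \<comment> \<open>An edge at \<open>u\<close> lies in only one triangle, so nothing joins the
    triangles \<open>u a a'\<close> and \<open>u b b'\<close> away from \<open>u\<close>.\<close>
  have n: "\<not> P a b" using uniq[OF a, of b a'] a' b by blast
  have n': "\<not> P a' b" using uniq[OF a'(1), of b a] a a' b sym by blast
  have ne: "b' \<noteq> a" "b' \<noteq> a'" "b' \<noteq> b" using n n' b' sym P_irrefl by blast+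
  have m: "\<not> P a b'" using uniq[OF a, of b' a'] a' b' ne by blast
  have m': "\<not> P a' b'" using uniq[OF a'(1), of b' a] a a' b' ne sym by blast
  obtain p where p: "P a p" "P b p" "p \<noteq> u" "\<not> P u p"
    using nonadjacent_common_nbr[OF a b(1) n b(2)[symmetric]] by blast
  obtain q where q: "P a q" "P b' q" "q \<noteq> u" "\<not> P u q"
    using nonadjacent_common_nbr[OF a b'(1) m ne(1)[symmetric]] by blast
  obtain r where r: "P a' r" "P b r" "r \<noteq> u" "\<not> P u r"
    using nonadjacent_common_nbr[OF a'(1) b(1) n' b(3)[symmetric]] by blast
  obtain s where s: "P a' s" "P b' s" "s \<noteq> u" "\<not> P u s"
    using nonadjacent_common_nbr[OF a'(1) b'(1) m' ne(2)[symmetric]] by blast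
  \<comment> \<open>A cell outside the first row and column thus has only one head in each of them,
    which separates \<open>p\<close>, \<open>q\<close>, \<open>r\<close>, \<open>s\<close>.\<close>
  have xa: "z = u" if "P a z" "P a' z" for z
    using uniq[OF a'(2) that, of u] a a' sym by blast
  have xb: "z = u" if "P b z" "P b' z" for z
    using uniq[OF b'(2) that, of u] b b' sym by blast
  have d1: "p \<noteq> q" "p \<noteq> r" "p \<noteq> s" "q \<noteq> r" "q \<noteq> s" "r \<noteq> s"
    using xa xb p q r s by blast+
  have d2: "u \<notin> {a, a', b, b', p, q, r, s}" using a a' b b' p q r s P_irrefl by blast
  have d3: "{p, q, r, s} \<inter> {a, a', b, b'} = {}" using a a' b b' p q r s by blast
  have dist: "distinct [u, a, a', b, b', p, q, r, s]"
    using d1 d2 d3 aa' b ne by auto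
  have sub: "{u, a, a', b, b', p, q, r, s} \<subseteq> A"
    using u a a' b b' p q r s P_dom by blast
  have "card {u, a, a', b, b', p, q, r, s} = 9" using dist by simp
  then have A: "A = {u, a, a', b, b', p, q, r, s}"
    using card_subset_eq[OF finite_A sub] card_A by simp
  have Nu: "{y. P u y} = {a, a', b, b'}"
    by (rule nbrs_eq) (use dist a a' b b' in simp_all)
  have Na: "{y. P a y} = {u, a', p, q}"
    by (rule nbrs_eq) (use dist a a' p q sym in simp_all)
  have Na': "{y. P a' y} = {u, a, r, s}"
    by (rule nbrs_eq) (use dist a' r s sym in simp_all)
  have Nb: "{y. P b y} = {u, b', p, r}"
    by (rule nbrs_eq) (use dist b b' p r sym in simp_all)
  have Nb': "{y. P b' y} = {u, b, q, s}"
    by (rule nbrs_eq) (use dist b' q s sym in simp_all)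
  \<comment> \<open>The edge \<open>a p\<close> lies in some triangle. Its third vertex is a
    neighbour of \<open>a\<close>, but neither \<open>u\<close> nor \<open>a'\<close> is adjacent to
    \<open>p\<close>, so it is \<open>q\<close>. The other three edges follow the same way.\<close>
  have pq: "P p q"
  proof -
    obtain z where z: "P a z" "P p z" using triangle[OF p(1)] by blast
    then have "z \<in> {u, a', p, q}" using Na by blast
    moreover have "z \<noteq> u" using z(2) p(4) sym by blast
    moreover have "z \<noteq> a'" using z(2) xa[OF p(1)] p(3) sym by blast
    ultimately show ?thesis using z(2) P_irrefl by blast
  qed
  have pr: "P p r"
  proof -
    obtain z where z: "P b z" "P p z" using triangle[OF p(2)] by blast
    then have "z \<in> {u, b', p, r}" using Nb by blast
    moreover have "z \<noteq> u" using z(2) p(4) sym by blast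
    moreover have "z \<noteq> b'" using z(2) xb[OF p(2)] p(3) sym by blast
    ultimately show ?thesis using z(2) P_irrefl by blast
  qed
  have sq: "P s q"
  proof -
    obtain z where z: "P b' z" "P s z" using triangle[OF s(2)] by blast
    then have "z \<in> {u, b, q, s}" using Nb' by blast
    moreover have "z \<noteq> u" using z(2) s(4) sym by blast
    moreover have "z \<noteq> b" using z(2) xb[OF _ s(2)] s(3) sym by blast
    ultimately show ?thesis using z(2) P_irrefl by blast
  qed
  have sr: "P s r"
  proof -
    obtain z where z: "P a' z" "P s z" using triangle[OF s(1)] by blast
    then have "z \<in> {u, a, r, s}" using Na' by blast
    moreover have "z \<noteq> u" using z(2) s(4) sym by blast
    moreover have "z \<noteq> a" using z(2) xa[OF _ s(1)] s(3) sym by blast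
    ultimately show ?thesis using z(2) P_irrefl by blast
  qed
  show thesis
  proof (rule that[OF A dist Nu Na Na' Nb Nb'])
    show "{y. P p y} = {a, b, q, r}"
      by (rule nbrs_eq) (use dist P_sym[OF p(1)] P_sym[OF p(2)] pq pr in simp_all)
    show "{y. P q y} = {a, b', p, s}"
      by (rule nbrs_eq) (use dist P_sym[OF q(1)] P_sym[OF q(2)] P_sym[OF pq] P_sym[OF sq] in simp_all)
    show "{y. P r y} = {a', b, p, s}"
      by (rule nbrs_eq) (use dist P_sym[OF r(1)] P_sym[OF r(2)] P_sym[OF pr] P_sym[OF sr] in simp_all)
    show "{y. P s y} = {a', b', q, r}"
      by (rule nbrs_eq) (use dist P_sym[OF s(1)] P_sym[OF s(2)] sq sr in simp_all)
  qed
qed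

lemma iso_SP9:
  obtains \<phi> where "bij_betw \<phi> A F9"
    "\<And>x y. x \<in> A \<Longrightarrow> y \<in> A \<Longrightarrow> x \<noteq> y \<Longrightarrow> P x y \<longleftrightarrow> F9_square (F9_sub (\<phi> y) (\<phi> x))"
proof -
  obtain u a a' b b' p q r s where
    A: "A = {u, a, a', b, b', p, q, r, s}" and dist: "distinct [u, a, a', b, b', p, q, r, s]"
    and N: "{y. P u y} = {a, a', b, b'}"
    "{y. P a y} = {u, a', p, q}"
    "{y. P a' y} = {u, a, r, s}"
    "{y. P b y} = {u, b', p, r}"
    "{y. P b' y} = {u, b, q, s}"
    "{y. P p y} = {a, b, q, r}"
    "{y. P q y} = {a, b', p, s}"
    "{y. P r y} = {a', b, p, s}"
    "{y. P s y} = {a', b', q, r}"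
    by (rule rook_grid) (rule that)
  \<comment> \<open>Row and column numbers in the grid; \<open>s\<close> keeps the default value (2,
    2).\<close>
  define \<phi> :: "'v \<Rightarrow> int \<times> int" where
    "\<phi> = (\<lambda>_. (2, 2))(u := (0, 0), a := (0, 1), a' := (0, 2), b := (1, 0), p := (1, 1),
      r := (1, 2), b' := (2, 0), q := (2, 1))"
  have P_iff: "P u y \<longleftrightarrow> y \<in> {a, a', b, b'}" "P a y \<longleftrightarrow> y \<in> {u, a', p, q}"
    "P a' y \<longleftrightarrow> y \<in> {u, a, r, s}" "P b y \<longleftrightarrow> y \<in> {u, b', p, r}"
    "P b' y \<longleftrightarrow> y \<in> {u, b, q, s}" "P p y \<longleftrightarrow> y \<in> {a, b, q, r}"
    "P q y \<longleftrightarrow> y \<in> {a, b', p, s}" "P r y \<longleftrightarrow> y \<in> {a', b, p, s}"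
    "P s y \<longleftrightarrow> y \<in> {a', b', q, r}" for y
    by (simp_all flip: N)
  have val: "\<phi> u = (0, 0)" "\<phi> a = (0, 1)" "\<phi> a' = (0, 2)" "\<phi> b = (1, 0)" "\<phi> p = (1, 1)"
    "\<phi> r = (1, 2)" "\<phi> b' = (2, 0)" "\<phi> q = (2, 1)" "\<phi> s = (2, 2)"
    using dist by (simp_all add: \<phi>_def eq_commute)
  have img: "\<phi> ` A = F9" unfolding A F9_eq image_insert image_empty val by (simp only: insert_commute)
  have "card F9 = 9" by (simp add: F9_def)
  then have "inj_on \<phi> A" using finite_A card_A img by (intro eq_card_imp_inj_on) simp_all
  then have bij: "bij_betw \<phi> A F9" using img by (simp add: bij_betw_def)
  have mem: "\<phi> x \<in> F9" if "x \<in> A" for x using img that by blast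
  show thesis
  proof (rule that[OF bij])
    fix x y assume xy: "x \<in> A" "y \<in> A" "x \<noteq> y"
    have "P x y \<longleftrightarrow> fst (\<phi> x) = fst (\<phi> y) \<or> snd (\<phi> x) = snd (\<phi> y)"
      using xy unfolding A
      apply (simp only: insert_iff empty_iff simp_thms)
      apply (elim disjE)
      using dist by (auto simp: P_iff val)
    then show "P x y \<longleftrightarrow> F9_square (F9_sub (\<phi> y) (\<phi> x))"
      using F9_square_sub_iff[OF mem mem] xy by simp
  qed
qed

end

section \<open>Signed homomorphisms of the cone\<close>

lemma resign_edge:
  assumes "{a, b} \<in> E" "a \<noteq> b"
  shows "{a, b} \<in> resign E X S \<longleftrightarrow> ({a, b} \<in> S) \<noteq> ((a \<in> X) \<noteq> (b \<in> X))"
proof -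
  have "card ({a, b} \<inter> X) = 1 \<longleftrightarrow> (a \<in> X) \<noteq> (b \<in> X)"
    using assms(2) by (cases "a \<in> X"; cases "b \<in> X") auto
  then show ?thesis using assms(1) by (simp add: resign_def)
qed

text \<open>Exclusive or of the three sign bits: the triangle is unbalanced, its product of signs
  being negative.\<close>

definition odd_triangle :: "'a set set \<Rightarrow> 'a \<Rightarrow> 'a \<Rightarrow> 'a \<Rightarrow> bool" where
  "odd_triangle S a b c \<longleftrightarrow> ({a, b} \<in> S) \<noteq> (({a, c} \<in> S) \<noteq> ({b, c} \<in> S))"

text \<open>Each vertex of the triangle that lies in \<open>X\<close> flips two of its edges, so the
  parity of negative edges is unchanged.\<close>

lemma odd_triangle_resign:
  assumes "{a, b} \<in> E" "{a, c} \<in> E" "{b, c} \<in> E" "a \<noteq> b" "a \<noteq> c" "b \<noteq> c"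
  shows "odd_triangle (resign E X S) a b c \<longleftrightarrow> odd_triangle S a b c"
  unfolding odd_triangle_def resign_edge[OF assms(1,4)] resign_edge[OF assms(2,5)]
    resign_edge[OF assms(3,6)]
  by argo

text \<open>The fan tree of depth 10 is rooted at 1 and fills the labels up to
  \<open>fan_size 10\<close>, leaving 0 for the apex.\<close>

definition cone_vertices :: "nat set" where
  "cone_vertices = {0..fan_size 10}"

definition cone_chords :: "(nat \<times> nat) set" where
  "cone_chords = {(a, b). \<exists>s. (a, b, s) \<in> fan_tree 10 1}"

definition cone_edges :: "nat set set" where
  "cone_edges = (\<lambda>i. {0, i}) ` {1..fan_size 10} \<union> (\<lambda>(i, j). {i, j}) ` cone_chords"

text \<open>All spokes are positive, so the triangle over a chord is unbalanced exactly when the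
  chord is negative.\<close>

definition cone_neg :: "nat set set" where
  "cone_neg = (\<lambda>(a, b, s). {a, b}) ` {(a, b, s) \<in> fan_tree 10 1. \<not> s}"

lemma cone_chord_bounds:
  assumes "(a, b, s) \<in> fan_tree 10 1"
  shows "0 < a \<and> a < b \<and> b \<le> fan_size 10"
proof -
  have "1 \<le> a \<and> a < b \<and> b < 1 + fan_size 10" using fan_tree_bounds[OF assms] .
  then show ?thesis by linarith
qed

lemma cone_planar: "planar cone_vertices cone_edges"
  unfolding cone_edges_def
proof (rule planar_apex_noncrossing)
  show "finite cone_vertices" "{1..fan_size 10} \<subseteq> cone_vertices - {0}" "0 \<in> cone_vertices"
    by (auto simp: cone_vertices_def)
  show "0 < i \<and> i < j \<and> i \<in> cone_vertices \<and> j \<in> cone_vertices" if ij: "(i, j) \<in> cone_chords" for i j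
  proof -
    obtain s where "(i, j, s) \<in> fan_tree 10 1" using ij unfolding cone_chords_def by blast
    from cone_chord_bounds[OF this] show ?thesis by (simp add: cone_vertices_def)
  qed
  show "nested_or_apart a b c d" if ab: "(a, b) \<in> cone_chords" and cd: "(c, d) \<in> cone_chords" for a b c d
  proof -
    obtain s where s: "(a, b, s) \<in> fan_tree 10 1" using ab unfolding cone_chords_def by blast
    obtain t where t: "(c, d, t) \<in> fan_tree 10 1" using cd unfolding cone_chords_def by blast
    show ?thesis using fan_tree_nested[OF s t] by blast
  qed
qed

lemma cone_chord_edge: "(a, b, s) \<in> fan_tree 10 1 \<Longrightarrow> {a, b} \<in> cone_edges"
  unfolding cone_edges_def cone_chords_def by fast

lemma cone_spoke_edge: "0 < i \<Longrightarrow> i \<le> fan_size 10 \<Longrightarrow> {0, i} \<in> cone_edges"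
  unfolding cone_edges_def by (intro UnI1 image_eqI[of _ _ i]) auto

lemma cone_neg_cases:
  assumes "e \<in> cone_neg"
  obtains c d where "e = {c, d}" "(c, d, False) \<in> fan_tree 10 1"
  using assms unfolding cone_neg_def by auto

text \<open>Passing to unordered edges forgets \<open>s\<close>; it is recovered because ordered
  ends are determined by the edge and no chord occurs with both signs.\<close>

lemma cone_chord_sign:
  assumes "(a, b, s) \<in> fan_tree 10 1"
  shows "{a, b} \<in> cone_neg \<longleftrightarrow> \<not> s"
proof
  assume "{a, b} \<in> cone_neg"
  then obtain c d where cd: "{a, b} = {c, d}" "(c, d, False) \<in> fan_tree 10 1"
    by (rule cone_neg_cases)
  have "a = c \<and> b = d"
    using cd(1) cone_chord_bounds[OF assms] cone_chord_bounds[OF cd(2)]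
    by (auto simp: doubleton_eq_iff)
  then show "\<not> s" using fan_tree_nested[OF assms cd(2)] by blast
next
  assume "\<not> s"
  then show "{a, b} \<in> cone_neg"
    using assms unfolding cone_neg_def by (intro image_eqI[of _ _ "(a, b, s)"]) auto
qed

lemma cone_spoke_sign: "{0, i} \<notin> cone_neg"
proof
  assume "{0, i} \<in> cone_neg"
  then obtain c d where "{0, i} = {c, d}" "(c, d, False) \<in> fan_tree 10 1" by (rule cone_neg_cases)
  then show False using cone_chord_bounds[of c d False] by (auto simp: doubleton_eq_iff)
qed

lemma cone_signified: "signified_graph cone_vertices cone_edges cone_neg"
  unfolding signified_graph_def simple_graph_def
proof (intro conjI ballI)
  show "finite cone_vertices" by (simp add: cone_vertices_def)
  show "cone_neg \<subseteq> cone_edges"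
  proof
    fix e assume "e \<in> cone_neg"
    then obtain c d where cd: "e = {c, d}" "(c, d, False) \<in> fan_tree 10 1" by (rule cone_neg_cases)
    show "e \<in> cone_edges" unfolding cd(1) by (rule cone_chord_edge[OF cd(2)])
  qed
  fix e assume "e \<in> cone_edges"
  then consider i where "e = {0, i}" "0 < i" "i \<le> fan_size 10"
    | a b s where "e = {a, b}" "(a, b, s) \<in> fan_tree 10 1"
    unfolding cone_edges_def cone_chords_def by fastforce
  then have "e \<subseteq> cone_vertices \<and> card e = 2"
  proof cases
    case 1 then show ?thesis by (simp add: cone_vertices_def)
  next
    case 2
    then show ?thesis using cone_chord_bounds[OF 2(2)] by (simp add: cone_vertices_def)
  qed
  then show "e \<subseteq> cone_vertices" "card e = 2" by blast+
qed

section \<open>Recognising the target from its triangles at one vertex\<close>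

lemma SP9p_E_eq: "SP9p_E = {e. e \<subseteq> SP9p_V \<and> card e = 2}"
proof (intro set_eqI iffI)
  fix e assume "e \<in> SP9p_E"
  then show "e \<in> {e. e \<subseteq> SP9p_V \<and> card e = 2}"
    by (auto simp: SP9p_E_def SP9_E_def SP9p_V_def)
next
  fix e assume "e \<in> {e. e \<subseteq> SP9p_V \<and> card e = 2}"
  then have "e \<subseteq> SP9p_V" "card e = 2" by simp_all
  then obtain x y where xy: "e = {x, y}" "x \<noteq> y" "x \<in> SP9p_V" "y \<in> SP9p_V"
    by (metis card_2_iff insert_subset)
  show "e \<in> SP9p_E"
  proof (cases x)
    case None
    then obtain b where "y = Some b" "b \<in> F9" using xy by (auto simp: SP9p_V_def)
    then have "e = {None, Some b}" using xy(1) None by simp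
    then show ?thesis using \<open>b \<in> F9\<close> unfolding SP9p_E_def by blast
  next
    case (Some a)
    then have a: "a \<in> F9" using xy by (auto simp: SP9p_V_def)
    show ?thesis
    proof (cases y)
      case None
      then have "e = {None, Some a}" using xy(1) Some by auto
      then show ?thesis using a unfolding SP9p_E_def by blast
    next
      case (Some b)
      then have "b \<in> F9" "a \<noteq> b" using xy \<open>x = Some a\<close> by (auto simp: SP9p_V_def)
      then have "{a, b} \<in> SP9_E" using a unfolding SP9_E_def by blast
      moreover have "e = Some ` {a, b}" using xy(1) Some \<open>x = Some a\<close> by simp
      ultimately show ?thesis unfolding SP9p_E_def by blast
    qed
  qed
qed

lemma SP9_S_iff:
  assumes "a \<in> F9" "b \<in> F9" "a \<noteq> b"
  shows "{a, b} \<in> SP9_S \<longleftrightarrow> \<not> F9_square (F9_sub b a)"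
proof
  assume "{a, b} \<in> SP9_S"
  then obtain x y where xy: "{a, b} = {x, y}" "x \<in> F9" "y \<in> F9" "\<not> F9_square (F9_sub y x)"
    unfolding SP9_S_def by blast
  have "a = x \<and> b = y \<or> a = y \<and> b = x" using xy(1) by (simp add: doubleton_eq_iff)
  then have "F9_square (F9_sub b a) \<longleftrightarrow> F9_square (F9_sub y x)"
    unfolding F9_square_sub_iff[OF assms(1,2)] F9_square_sub_iff[OF xy(2,3)]
    by (elim disjE conjE) (simp_all add: eq_commute)
  then show "\<not> F9_square (F9_sub b a)" using xy(4) by simp
next
  assume "\<not> F9_square (F9_sub b a)"
  then show "{a, b} \<in> SP9_S" using assms unfolding SP9_S_def by blast
qed

lemma SP9p_S_iff: "{Some a, Some b} \<in> SP9p_S \<longleftrightarrow> {a, b} \<in> SP9_S"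
proof -
  have "(`) Some {a, b} \<in> (`) Some ` SP9_S \<longleftrightarrow> {a, b} \<in> SP9_S"
    by (rule inj_image_mem_iff) (simp add: inj_def inj_image_eq_iff)
  then show ?thesis unfolding SP9p_S_def by simp
qed

lemma None_notin_SP9p_S: "{None, x} \<notin> SP9p_S"
proof
  assume "{None, x} \<in> SP9p_S"
  then obtain e where "{None, x} = Some ` e" unfolding SP9p_S_def by blast
  moreover have "None \<in> {None, x}" by simp
  ultimately have "None \<in> Some ` e" by (simp only:)
  then show False by blast
qed

text \<open>Resigning the vertices joined negatively to \<open>h\<close> makes every edge at
  \<open>h\<close> positive. The sign of any other edge \<open>x y\<close> then equals the parity of
  the triangle \<open>h x y\<close>, and \<open>h\<close> takes the place of the added
  vertex.\<close>

lemma SP9p_iso_of_link: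
  fixes H :: "'v set" and EH \<Lambda> :: "'v set set"
  assumes EH: "EH = {e. e \<subseteq> H \<and> card e = 2}" and \<Lambda>: "\<Lambda> \<subseteq> EH" and h: "h \<in> H"
    and bij: "bij_betw \<phi> (H - {h}) F9"
    and sq: "\<And>x y. x \<in> H - {h} \<Longrightarrow> y \<in> H - {h} \<Longrightarrow> x \<noteq> y \<Longrightarrow>
      odd_triangle \<Lambda> h x y \<longleftrightarrow> \<not> F9_square (F9_sub (\<phi> y) (\<phi> x))"
  shows "iso_up_to_resigning H EH \<Lambda> SP9p_V SP9p_E SP9p_S"
proof -
  define X where "X = {v \<in> H. {h, v} \<in> \<Lambda>}"
  define \<psi> where "\<psi> v = (if v = h then None else Some (\<phi> v))" for v
  have hX: "h \<notin> X" using \<Lambda> EH by (auto simp: X_def)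
  have inj: "inj_on \<psi> H"
    using bij by (auto simp: \<psi>_def inj_on_def bij_betw_def)
  have "\<psi> ` H = insert None (Some ` \<phi> ` (H - {h}))"
    using h by (auto simp: \<psi>_def image_iff)
  then have img: "\<psi> ` H = SP9p_V" using bij by (simp add: SP9p_V_def bij_betw_def)
  have E: "e \<in> EH \<longleftrightarrow> \<psi> ` e \<in> SP9p_E" if "e \<subseteq> H" for e
  proof -
    have "card (\<psi> ` e) = card e" using inj that by (meson card_image inj_on_subset)
    then show ?thesis using that img by (auto simp: EH SP9p_E_eq)
  qed
  have spoke: "{h, x} \<in> resign EH X \<Lambda> \<longleftrightarrow> \<psi> ` {h, x} \<in> SP9p_S" if x: "x \<in> H" "x \<noteq> h" for x
  proof -
    have "{h, x} \<in> EH" using x h by (auto simp: EH)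
    then have "{h, x} \<notin> resign EH X \<Lambda>"
      using resign_edge[of h x EH X \<Lambda>] hX x by (auto simp: X_def)
    moreover have "\<psi> ` {h, x} = {None, \<psi> x}" by (simp add: \<psi>_def)
    ultimately show ?thesis by (simp add: None_notin_SP9p_S)
  qed
  have S: "e \<in> resign EH X \<Lambda> \<longleftrightarrow> \<psi> ` e \<in> SP9p_S" if e: "e \<in> EH" for e
  proof -
    obtain x y where xy: "e = {x, y}" "x \<noteq> y" "x \<in> H" "y \<in> H"
      using e unfolding EH by (auto simp: card_2_iff)
    show ?thesis
    proof (cases "x = h \<or> y = h")
      case True
      then obtain z where "e = {h, z}" "z \<in> H" "z \<noteq> h" using xy by blast
      then show ?thesis using spoke by simp
    next
      case False
      have F: "\<phi> x \<in> F9" "\<phi> y \<in> F9" "\<phi> x \<noteq> \<phi> y"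
        using bij xy False by (auto simp: bij_betw_def inj_on_def)
      have "e \<in> resign EH X \<Lambda> \<longleftrightarrow> odd_triangle \<Lambda> h x y"
        using resign_edge[of x y EH X \<Lambda>] e xy by (auto simp: X_def odd_triangle_def)
      also have "\<dots> \<longleftrightarrow> {\<phi> x, \<phi> y} \<in> SP9_S"
        using sq[of x y] SP9_S_iff[OF F] xy False by simp
      also have "\<dots> \<longleftrightarrow> \<psi> ` e \<in> SP9p_S"
        using False by (simp add: xy(1) \<psi>_def SP9p_S_iff)
      finally show ?thesis .
    qed
  qed
  show ?thesis
    unfolding iso_up_to_resigning_def
  proof (intro exI[of _ X] exI[of _ \<psi>] conjI allI impI ballI)
    show "X \<subseteq> H" by (auto simp: X_def)
    show "bij_betw \<psi> H SP9p_V" using inj img by (simp add: bij_betw_def)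
  qed (use E S in simp_all)
qed

section \<open>Applying the cone to an arbitrary target on ten vertices\<close>

theorem mainTheorem18:
  fixes H :: "'v set" and EH :: "'v set set" and \<Lambda> :: "'v set set"
  assumes "signified_graph H EH \<Lambda>"
    and "card H = 10"
    and "\<forall>(V :: nat set) E S. signified_graph V E S \<and> planar V E \<longrightarrow>
           signed_hom_exists V E S H EH \<Lambda>"
  shows "iso_up_to_resigning H EH \<Lambda> SP9p_V SP9p_E SP9p_S"
proof -
  have edgeH: "e \<subseteq> H \<and> card e = 2" if "e \<in> EH" for e
    using assms(1) that by (auto simp: signified_graph_def simple_graph_def)
  have \<Lambda>: "\<Lambda> \<subseteq> EH" and finH: "finite H"
    using assms(1) by (simp_all add: signified_graph_def simple_graph_def)
  have "signed_hom_exists cone_vertices cone_edges cone_neg H EH \<Lambda>"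
    using assms(3) cone_signified cone_planar by blast
  then obtain X Y f where
    hom: "signified_hom cone_vertices cone_edges (resign cone_edges X cone_neg) H EH (resign EH Y \<Lambda>) f"
    unfolding signed_hom_exists_def by blast
  have f: "f ` e \<in> EH" "f ` e \<in> resign EH Y \<Lambda> \<longleftrightarrow> e \<in> resign cone_edges X cone_neg"
    if "e \<in> cone_edges" for e
    using hom that unfolding signified_hom_def by blast+
  have ne: "x \<noteq> y" if "{x, y} \<in> EH" for x y using edgeH[OF that] by auto
  define h where "h = f 0"
  define A where "A = {x. {h, x} \<in> EH}"
  \<comment> \<open>\<open>True\<close> stands for a balanced triangle. Parity ignores resigning, so
    \<open>\<Lambda>\<close> itself can be used although the map respects only resigned
    signs.\<close>
  define R where "R s x y \<longleftrightarrow> x \<in> A \<and> y \<in> A \<and> {x, y} \<in> EH \<and> s = (\<not> odd_triangle \<Lambda> h x y)" for s x y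
  have fA: "f a \<in> A" if "0 < a" "a \<le> fan_size 10" for a
    using f(1)[OF cone_spoke_edge[OF that]] by (simp add: A_def h_def)
  have fR: "R s (f a) (f b)" if ab: "(a, b, s) \<in> fan_tree 10 1" for a b s
  proof -
    note bd = cone_chord_bounds[OF ab]
    have e: "{0, a} \<in> cone_edges" "{0, b} \<in> cone_edges" "{a, b} \<in> cone_edges"
      using bd by (auto intro: cone_spoke_edge cone_chord_edge[OF ab])
    have fe: "{h, f a} \<in> EH" "{h, f b} \<in> EH" "{f a, f b} \<in> EH"
      using f(1)[OF e(1)] f(1)[OF e(2)] f(1)[OF e(3)] by (simp_all add: h_def)
    \<comment> \<open>Undo the resigning in the target, pull the signs back along \<open>f\<close>,
      then undo the resigning of the cone.\<close>
    have "odd_triangle \<Lambda> h (f a) (f b) \<longleftrightarrow> odd_triangle (resign EH Y \<Lambda>) h (f a) (f b)"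
      using odd_triangle_resign[OF fe] fe ne by blast
    also have "\<dots> \<longleftrightarrow> odd_triangle (resign cone_edges X cone_neg) 0 a b"
      using f(2)[OF e(1)] f(2)[OF e(2)] f(2)[OF e(3)] by (simp add: odd_triangle_def h_def)
    also have "\<dots> \<longleftrightarrow> odd_triangle cone_neg 0 a b"
      using odd_triangle_resign[OF e] bd by simp
    also have "\<dots> \<longleftrightarrow> \<not> s"
      by (simp add: odd_triangle_def cone_spoke_sign cone_chord_sign[OF ab])
    finally show ?thesis using fe by (simp add: R_def A_def)
  qed
  have AH: "A \<subseteq> H - {h}" using edgeH ne unfolding A_def by blast
  have "f 1 \<in> A" using fan_size_pos[of 10] by (intro fA) auto
  then have hH: "h \<in> H" using edgeH unfolding A_def by blast
  then have cardH: "card (H - {h}) = 9" using assms(2) by simp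
  interpret signed_relation A R
  proof
    show "finite A" using AH finH finite_subset by blast
    show "card A \<le> 9" using card_mono[OF _ AH] finH cardH by simp
    show "R s y x" if "R s x y" for s x y
      using that by (auto simp: R_def odd_triangle_def insert_commute)
    show "\<not> R s x x" for s x using ne unfolding R_def by blast
    show "s = t" if "R s x y" "R t x y" for s t x y using that by (simp add: R_def)
    show "x \<in> A" if "R s x y" for s x y using that by (simp add: R_def)
  qed
  obtain U where U: "fan_op U = U" "U \<noteq> {}"
  proof (rule fan_tree_hom_fixpoint[of 1 f])
    show "R s (f a) (f b)" if "(a, b, s) \<in> fan_tree 10 1" for a b s by (rule fR[OF that])
    show "f a \<in> A" if "1 \<le> a" "a < 1 + fan_size 10" for a using that by (intro fA) auto
  qed (rule that)
  note paley = fan_op_fixpoint_paley[OF U]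
  \<comment> \<open>Only now is \<open>h\<close> known to be adjacent to all nine other
    vertices.\<close>
  have A: "A = H - {h}" using card_subset_eq[OF _ AH] finH cardH paley(1) by simp
  interpret paley_nine A "R True"
  proof
    show "finite A" by (rule finite_A)
    show "card A = 9" by (rule paley(1))
    show "R True y x" if "R True x y" for x y using that by (rule R_sym)
    show "\<not> R True x x" for x by (rule R_irrefl)
    show "x \<in> A \<and> y \<in> A" if "R True x y" for x y using that by (simp add: R_def)
    show "card {y. R True x y} = 4" if "x \<in> A" for x using that by (rule paley(3))
    show "\<exists>z. R True x z \<and> R True y z" if "R True x y" for x y using that by (rule paley(4))
    show "\<exists>z\<in>A. z \<noteq> x \<and> z \<noteq> y \<and> \<not> R True x z \<and> \<not> R True y z"
      if xy: "x \<in> A" "y \<in> A" "x \<noteq> y" "\<not> R True x y" for x y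
    proof -
      \<comment> \<open>A coloured pair that is not positive is negative, and every negative pair
        extends to an all-negative triangle in \<open>A\<close>.\<close>
      obtain s where "R s x y" using paley(2)[OF xy(1-3)] by blast
      then have "R False x y" using xy(4) by (cases s) simp_all
      then obtain z where z: "R False x z" "R False y z" using paley(4) by blast
      then have "\<not> R True x z" "\<not> R True y z" using R_unique by blast+
      moreover have "z \<noteq> x" "z \<noteq> y" using z R_irrefl by blast+
      moreover have "z \<in> A" using z(1) by (simp add: R_def)
      ultimately show ?thesis by blast
    qed
  qed
  obtain \<phi> where \<phi>: "bij_betw \<phi> A F9"
    "\<And>x y. x \<in> A \<Longrightarrow> y \<in> A \<Longrightarrow> x \<noteq> y \<Longrightarrow> R True x y \<longleftrightarrow> F9_square (F9_sub (\<phi> y) (\<phi> x))"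
    by (rule iso_SP9) (rule that)
  have edgeA: "{x, y} \<in> EH" if "x \<in> A" "y \<in> A" "x \<noteq> y" for x y
    using paley(2)[OF that] by (auto simp: R_def)
  have "EH = {e. e \<subseteq> H \<and> card e = 2}"
  proof (intro equalityI subsetI)
    fix e assume "e \<in> {e. e \<subseteq> H \<and> card e = 2}"
    then obtain x y where xy: "e = {x, y}" "x \<noteq> y" "x \<in> H" "y \<in> H" by (auto simp: card_2_iff)
    have spoke: "{h, z} \<in> EH" if "z \<in> H" "z \<noteq> h" for z using that A by (auto simp: A_def)
    show "e \<in> EH"
    proof (cases "x = h \<or> y = h")
      case True
      then obtain z where "e = {h, z}" "z \<in> H" "z \<noteq> h" using xy by blast
      then show ?thesis using spoke by simp
    next
      case False
      then show ?thesis using edgeA[of x y] xy A by simp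
    qed
  qed (use edgeH in simp)
  then show ?thesis
  proof (rule SP9p_iso_of_link[OF _ \<Lambda> hH])
    show "bij_betw \<phi> (H - {h}) F9" using \<phi>(1) A by simp
    show "odd_triangle \<Lambda> h x y \<longleftrightarrow> \<not> F9_square (F9_sub (\<phi> y) (\<phi> x))"
      if "x \<in> H - {h}" "y \<in> H - {h}" "x \<noteq> y" for x y
    proof -
      have xy: "x \<in> A" "y \<in> A" using that A by blast+
      then have "R True x y \<longleftrightarrow> \<not> odd_triangle \<Lambda> h x y" using edgeA that(3) by (simp add: R_def)
      then show ?thesis using \<phi>(2)[OF xy that(3)] by blast
    qed
  qed
qed

end
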